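(* Let $p$ be an odd prime number and let $S\subset\mathbb Z_p$. If $S=\mathcal C(D,C)$ for some nontrivially Dehn $p$-colored diagram $(D,C)$ of a knot, then the $\mathcal R$-palette graph $G_S$ includes a connected $\mathcal R$-subgraph with at least $\lfloor\log_2 p\rfloor+2$ vertices.
   Context: $\mathbb Z_p=\mathbb Z/p\mathbb Z$. Dehn colorings: let $D$ be a diagram of a knot, and let $\mathcal R(D)$ be the set of regions of $D$ (connected components of the complement of the underlying immersed curve). At each crossing the four surrounding regions are named $x_1,x_2,x_3,x_4$ (not necessarily distinct) so that $x_2$ is adjacent to $x_1$ across an under-arc, $x_3$ is adjacent to $x_1$ across the over-arc, and $x_4$ is opposite to $x_1$. A Dehn $p$-coloring of $D$ is a map $C:\mathcal R(D)\to\mathbb Z_p$ such that $C(x_1)+C(x_3)=C(x_2)+C(x_4)$ at each crossing. A crossing is trivially colored if $C(x_1)=C(x_4)$ and $C(x_3)=C(x_2)$ there; $C$ is trivial if every crossing is trivially colored, and nontrivial otherwise. A nontrivially Dehn $p$-colored diagram is a pair $(D,C)$ with $C$ a nontrivial Dehn $p$-coloring of $D$, and $\mathcal C(D,C)=\mathrm{Im}\,C$. Palette graphs: let $\emptyset\neq S\subset\mathbb Z_p$. Let $\mu(S)=\{\{a_1,a_2\}\mid a_1,a_2\in S\}$ be the set of two-element multisets from $S$ (the multiset $\{a_1,a_1\}$ is allowed). Put $\{a_1,a_2\}\sim\{a_3,a_4\}$ if $a_1+a_2=a_3+a_4$ in $\mathbb Z_p$, and write $\overline{a_1+a_2}$ for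 the equivalence class of $\{a_1,a_2\}$ (so classes are identified with the elements $b=a_1+a_2$ of $\mathbb Z_p$). The $\mathcal R$-palette graph of $S$ is the simple graph $G_S=(V_S,E_S)$ with vertex set $V_S=\mu(S)/\!\sim$, in which two distinct vertices $\overline{b_1},\overline{b_2}$ are joined by an edge if and only if there exist $\{a_1,a_2\}\in\overline{b_1}$ and $\{a_3,a_4\}\in\overline{b_2}$ with $a_1+a_3=a_2+a_4$ or $a_1+a_4=a_2+a_3$ in $\mathbb Z_p$. The edge between $\overline{b_1}$ and $\overline{b_2}$ carries the label $\overline{2^{-1}(b_1+b_2)}$, where $2^{-1}(b_1+b_2)\in\mathbb Z_p$. An $\mathcal R$-subgraph of $G_S$ is a subgraph $G=(V,E)$ of $G_S$ such that for every edge $e\in E$ joining $\overline{b_1}$ and $\overline{b_2}$, its label satisfies $\overline{2^{-1}(b_1+b_2)}\in V$. *)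

theory Defs
  imports
    "HOL-Analysis.Analysis"
    "HOL-Number_Theory.Number_Theory"
    "HOL-Number_Theory.Modular_Inverse"
    "HOL-Library.Multiset"
begin

section \<open>Knot diagrams\<close>

text \<open>
  The immersed circle underlying a diagram is given by a 1-periodic \<open>C\<^sup>1\<close> curve in the plane
  \<^typ>\<open>complex\<close>. Since there is a single curve, the diagram is one of a knot.
\<close>

definition velocity :: "(real \<Rightarrow> complex) \<Rightarrow> real \<Rightarrow> complex" where
  "velocity \<gamma> t = vector_derivative \<gamma> (at t)"

definition immersed_circle :: "(real \<Rightarrow> complex) \<Rightarrow> bool" where
  "immersed_circle \<gamma> \<longleftrightarrow>
     (\<forall>t. \<gamma> (t + 1) = \<gamma> t) \<and>
     \<gamma> C1_differentiable_on UNIV \<and>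
     (\<forall>t. velocity \<gamma> t \<noteq> 0)"

text \<open>Every double point of the curve contributes both \<open>(s, t)\<close> and \<open>(t, s)\<close>.\<close>

definition double_points :: "(real \<Rightarrow> complex) \<Rightarrow> (real \<times> real) set" where
  "double_points \<gamma> = {(s, t). s \<in> {0..<1} \<and> t \<in> {0..<1} \<and> s \<noteq> t \<and> \<gamma> s = \<gamma> t}"

definition generic_immersed_circle :: "(real \<Rightarrow> complex) \<Rightarrow> bool" where
  "generic_immersed_circle \<gamma> \<longleftrightarrow>
     immersed_circle \<gamma> \<and>
     finite (double_points \<gamma>) \<and>
     (\<forall>s t t'. (s, t) \<in> double_points \<gamma> \<and> (s, t') \<in> double_points \<gamma> \<longrightarrow> t = t') \<and>
     (\<forall>(s, t) \<in> double_points \<gamma>. velocity \<gamma> s \<notin> span {velocity \<gamma> t})"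

text \<open>
  The over/under information is a choice, at each double point, of one of its two parameter
  pairs: \<open>(s, t) \<in> X\<close> means that the strand through parameter \<open>s\<close> passes over the
  strand through parameter \<open>t\<close>.
\<close>

definition knot_diagram :: "(real \<Rightarrow> complex) \<Rightarrow> (real \<times> real) set \<Rightarrow> bool" where
  "knot_diagram \<gamma> X \<longleftrightarrow>
     generic_immersed_circle \<gamma> \<and>
     X \<subseteq> double_points \<gamma> \<and>
     (\<forall>(s, t) \<in> double_points \<gamma>. (s, t) \<in> X \<longleftrightarrow> (t, s) \<notin> X)"

definition regions :: "(real \<Rightarrow> complex) \<Rightarrow> complex set set" where
  "regions \<gamma> = components (- range \<gamma>)"

definition region_towards :: "(real \<Rightarrow> complex) \<Rightarrow> complex \<Rightarrow> complex \<Rightarrow> complex set \<Rightarrow> bool" where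
  "region_towards \<gamma> P w R \<longleftrightarrow>
     R \<in> regions \<gamma> \<and> (\<forall>\<^sub>F e in at_right (0::real). P + e *\<^sub>R w \<in> R)"

text \<open>
  Let \<open>u\<close> and \<open>v\<close> be the velocities of the over-arc and of the under-arc at a
  crossing. The four sectors cut out by the two strands contain the directions
  \<open>\<plusminus> u \<plusminus> v\<close>; reversing the sign of \<open>u\<close> passes across an under-arc, reversing the
  sign of \<open>v\<close> passes across the over-arc. The choice of signs reflects that any of the four
  regions may be the one called \<open>x1\<close>.
\<close>

definition surrounding_regions ::
  "(real \<Rightarrow> complex) \<Rightarrow> real \<times> real \<Rightarrow>
     complex set \<Rightarrow> complex set \<Rightarrow> complex set \<Rightarrow> complex set \<Rightarrow> bool" where
  "surrounding_regions \<gamma> c x1 x2 x3 x4 \<longleftrightarrow>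
     (\<exists>u \<in> {velocity \<gamma> (fst c), - velocity \<gamma> (fst c)}.
      \<exists>v \<in> {velocity \<gamma> (snd c), - velocity \<gamma> (snd c)}.
        region_towards \<gamma> (\<gamma> (fst c)) (u + v) x1 \<and>
        region_towards \<gamma> (\<gamma> (fst c)) (- u + v) x2 \<and>
        region_towards \<gamma> (\<gamma> (fst c)) (u - v) x3 \<and>
        region_towards \<gamma> (\<gamma> (fst c)) (- u - v) x4)"


section \<open>Dehn colorings\<close>

text \<open>The elements of \<open>\<int>/p\<int>\<close> are represented by their residues in \<open>{0..<p}\<close>.\<close>

definition Zmod :: "nat \<Rightarrow> int set" where
  "Zmod p = {0..<int p}"

definition dehn_coloring ::
  "nat \<Rightarrow> (real \<Rightarrow> complex) \<Rightarrow> (real \<times> real) set \<Rightarrow> (complex set \<Rightarrow> int) \<Rightarrow> bool" where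
  "dehn_coloring p \<gamma> X C \<longleftrightarrow>
     C \<in> regions \<gamma> \<rightarrow> Zmod p \<and>
     (\<forall>c \<in> X. \<forall>x1 x2 x3 x4. surrounding_regions \<gamma> c x1 x2 x3 x4 \<longrightarrow>
        [C x1 + C x3 = C x2 + C x4] (mod int p))"

definition trivially_colored ::
  "(real \<Rightarrow> complex) \<Rightarrow> (complex set \<Rightarrow> int) \<Rightarrow> real \<times> real \<Rightarrow> bool" where
  "trivially_colored \<gamma> C c \<longleftrightarrow>
     (\<forall>x1 x2 x3 x4. surrounding_regions \<gamma> c x1 x2 x3 x4 \<longrightarrow> C x1 = C x4 \<and> C x3 = C x2)"

definition nontrivial_coloring ::
  "(real \<Rightarrow> complex) \<Rightarrow> (real \<times> real) set \<Rightarrow> (complex set \<Rightarrow> int) \<Rightarrow> bool" where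
  "nontrivial_coloring \<gamma> X C \<longleftrightarrow> \<not> (\<forall>c \<in> X. trivially_colored \<gamma> C c)"

definition nontrivially_colored_diagram ::
  "nat \<Rightarrow> (real \<Rightarrow> complex) \<Rightarrow> (real \<times> real) set \<Rightarrow> (complex set \<Rightarrow> int) \<Rightarrow> bool" where
  "nontrivially_colored_diagram p \<gamma> X C \<longleftrightarrow>
     knot_diagram \<gamma> X \<and> dehn_coloring p \<gamma> X C \<and> nontrivial_coloring \<gamma> X C"

definition color_set :: "(real \<Rightarrow> complex) \<Rightarrow> (complex set \<Rightarrow> int) \<Rightarrow> int set" where
  "color_set \<gamma> C = C ` regions \<gamma>"


section \<open>Palette graphs\<close>

definition two_multisets :: "int set \<Rightarrow> int multiset set" where
  "two_multisets S = {{#a1, a2#} | a1 a2. a1 \<in> S \<and> a2 \<in> S}"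

definition same_sum :: "nat \<Rightarrow> int set \<Rightarrow> (int multiset \<times> int multiset) set" where
  "same_sum p S = {(M, N). M \<in> two_multisets S \<and> N \<in> two_multisets S \<and>
     [\<Sum>\<^sub># M = \<Sum>\<^sub># N] (mod int p)}"

definition palette_vertices :: "nat \<Rightarrow> int set \<Rightarrow> int multiset set set" where
  "palette_vertices p S = two_multisets S // same_sum p S"

text \<open>
  The class written as a bar over \<open>b\<close>. It is empty if \<open>b\<close> is not a sum of two elements
  of \<open>S\<close>, in which case it is not a vertex.
\<close>

definition sum_class :: "nat \<Rightarrow> int set \<Rightarrow> int \<Rightarrow> int multiset set" where
  "sum_class p S b = {M \<in> two_multisets S. [\<Sum>\<^sub># M = b] (mod int p)}"

lemma equiv_same_sum: "equiv (two_multisets S) (same_sum p S)"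
proof (rule equivI)
  show "same_sum p S \<subseteq> two_multisets S \<times> two_multisets S"
    unfolding same_sum_def by blast
  show "refl_on (two_multisets S) (same_sum p S)"
    unfolding same_sum_def refl_on_def by simp
  show "sym (same_sum p S)"
    unfolding same_sum_def sym_def by (simp add: cong_def)
  show "trans (same_sum p S)"
    unfolding same_sum_def trans_def by (simp add: cong_def)
qed

lemma palette_vertices_eq:
  "palette_vertices p S = {sum_class p S (a1 + a2) | a1 a2. a1 \<in> S \<and> a2 \<in> S}"
proof -
  have image: "same_sum p S `` {M} = sum_class p S (\<Sum>\<^sub># M)" if "M \<in> two_multisets S" for M
    using that unfolding same_sum_def sum_class_def Image_def by (simp add: cong_def eq_commute)
  have "palette_vertices p S = (\<lambda>M. same_sum p S `` {M}) ` two_multisets S"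
    unfolding palette_vertices_def quotient_def by blast
  also have "\<dots> = (\<lambda>M. sum_class p S (\<Sum>\<^sub># M)) ` two_multisets S"
    using image by (rule image_cong[OF refl])
  also have "\<dots> = {sum_class p S (\<Sum>\<^sub># {#a1, a2#}) | a1 a2. a1 \<in> S \<and> a2 \<in> S}"
    unfolding two_multisets_def by blast
  finally show ?thesis
    by simp
qed

definition palette_edges :: "nat \<Rightarrow> int set \<Rightarrow> int multiset set set set" where
  "palette_edges p S =
     {{B1, B2} | B1 B2. B1 \<in> palette_vertices p S \<and> B2 \<in> palette_vertices p S \<and> B1 \<noteq> B2 \<and>
        (\<exists>a1 a2 a3 a4. {#a1, a2#} \<in> B1 \<and> {#a3, a4#} \<in> B2 \<and>
           ([a1 + a3 = a2 + a4] (mod int p) \<or> [a1 + a4 = a2 + a3] (mod int p)))}"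

definition subgraph_of :: "'v set \<Rightarrow> 'v set set \<Rightarrow> 'v set \<Rightarrow> 'v set set \<Rightarrow> bool" where
  "subgraph_of V E V' E' \<longleftrightarrow> V \<subseteq> V' \<and> E \<subseteq> E' \<and> (\<forall>e \<in> E. e \<subseteq> V)"

definition connected_graph :: "'v set \<Rightarrow> 'v set set \<Rightarrow> bool" where
  "connected_graph V E \<longleftrightarrow>
     V \<noteq> {} \<and> (\<forall>x \<in> V. \<forall>y \<in> V. (x, y) \<in> {(a, b). {a, b} \<in> E}\<^sup>*)"

definition edge_label :: "nat \<Rightarrow> int set \<Rightarrow> int \<Rightarrow> int \<Rightarrow> int multiset set" where
  "edge_label p S b1 b2 = sum_class p S (modular_inverse (int p) 2 * (b1 + b2))"

definition R_subgraph ::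
  "nat \<Rightarrow> int set \<Rightarrow> int multiset set set \<Rightarrow> int multiset set set set \<Rightarrow> bool" where
  "R_subgraph p S V E \<longleftrightarrow>
     subgraph_of V E (palette_vertices p S) (palette_edges p S) \<and>
     (\<forall>b1 b2. {sum_class p S b1, sum_class p S b2} \<in> E \<longrightarrow> edge_label p S b1 b2 \<in> V)"

end

theory Submission
  imports Defs "Jordan_Normal_Form.Determinant"
begin

text \<open>
  Giving each arc the sum of the colours of the two regions along it turns a Dehn coloring into a Fox
  coloring: at a crossing, the over-arc keeps its colour \<open>b\<close> and the two under-arcs have colours
  \<open>b1\<close>, \<open>b2\<close> with \<open>b1 + b2 = 2 * b\<close>. Hence the arc colours, joined by one
  edge for each crossing with \<open>b1 \<noteq> b2\<close>, form an \<open>\<R>\<close>-subgraph, which is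
  connected because one can travel along the knot.

  If it has \<open>m + 1\<close> vertices, a spanning tree yields an \<open>m \<times> m\<close> integer matrix
  whose rows are \<open>e b1 + e b2 - 2 * e b\<close> with the coordinate of the root deleted. Modulo 2 it
  is triangular with unit diagonal, so its determinant is odd. Each row is a sum of two rows of a reduced
  incidence matrix of a directed graph, and those matrices have determinant at most 1 in absolute value, so
  the determinant is at most \<open>2 ^ m\<close> in absolute value. The coloring is a kernel vector modulo
  \<open>p\<close>, so \<open>p\<close> divides the determinant and \<open>p < 2 ^ m\<close>.
\<close>

section \<open>Determinants of incidence matrices\<close>

text \<open>A crossing supplies exactly what an edge of the palette graph asks for. If x1 + x2 and
  x3 + x4 are the sums along the two under-arcs, then the Dehn relation x1 + x3 = x2 + x4 is the
  edge condition, and half the sum of the two under-arc colours is x1 + x3, the colour of the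
  over-arc. This keeps labels inside the vertex set. The summand 2 in the bound: m exceeds log2 p
  strictly, because an odd p is not 2 ^ m, and there are m + 1 vertices. The obstacle is geometric.
  Regions are components of the complement of a C1 curve, and arcs are not given as objects at all.
  A colour is therefore attached to a parameter t, through the regions just left and right of
  \<open>\<gamma> t\<close>, and only local facts are needed: how the complement looks near a simple
  point and near a transversal crossing. The two sides of a strand are never shown to be different
  regions, and travelling along the knot becomes the connectedness of the real line.\<close>

text \<open>An index \<open>x\<close> or \<open>y\<close> outside the range of \<open>j\<close> stands for the deleted vertex.\<close>

definition arrow_row :: "nat \<Rightarrow> nat \<Rightarrow> nat \<Rightarrow> int" where
  "arrow_row x y j = of_bool (j = x) - of_bool (j = y)"

text \<open>Total unimodularity of incidence matrices. If no arrow touches the deleted vertex, all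
  rows sum to zero and the matrix is singular. Otherwise some row has at most one nonzero entry, and
  expanding along it leaves a smaller matrix of the same kind.\<close>

lemma det_arrow_rows_le_1:
  "\<bar>Determinant.det (Matrix.mat n n (\<lambda>(i, j). arrow_row (x i) (y i) j))\<bar> \<le> 1"
proof (induction n arbitrary: x y)
  case 0
  then show ?case by (simp add: det_dim_zero)
next
  case (Suc n)
  define A where "A = Matrix.mat (Suc n) (Suc n) (\<lambda>(i, j). arrow_row (x i) (y i) j)"
  have A: "A \<in> carrier_mat (Suc n) (Suc n)"
    by (simp add: A_def)
  show ?case
  proof (cases "\<forall>i<Suc n. x i < Suc n \<and> y i < Suc n")
    case True
    define v :: "int Matrix.vec" where "v = Matrix.vec (Suc n) (\<lambda>_. 1)"
    have "A *\<^sub>v v = 0\<^sub>v (Suc n)"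
    proof (rule eq_vecI)
      fix i assume "i < dim_vec (0\<^sub>v (Suc n) :: int Matrix.vec)"
      then have i: "i < Suc n" by simp
      have "vec_index (A *\<^sub>v v) i = (\<Sum>j\<in>{0..<Suc n}. arrow_row (x i) (y i) j)"
        using i by (simp add: A_def v_def scalar_prod_def del: sum.op_ivl_Suc)
      also have "\<dots> = 0"
        using True i by (simp add: arrow_row_def sum_subtractf of_bool_def sum.delta del: sum.op_ivl_Suc)
      finally show "vec_index (A *\<^sub>v v) i = vec_index (0\<^sub>v (Suc n)) i" using i by simp
    qed (simp add: A_def)
    moreover have "v \<noteq> 0\<^sub>v (Suc n)"
    proof
      assume "v = 0\<^sub>v (Suc n)"
      then have "vec_index v 0 = 0" by simp
      then show False by (simp add: v_def)
    qed
    moreover have "v \<in> carrier_vec (Suc n)" by (simp add: v_def)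
    ultimately have "Determinant.det A = 0"
      using det_0_iff_vec_prod_zero[OF A] by blast
    then show ?thesis by (simp add: A_def)
  next
    case False
    then obtain i where i: "i < Suc n" and out: "x i \<ge> Suc n \<or> y i \<ge> Suc n"
      by force
    have "\<exists>k<Suc n. \<exists>a. \<bar>a\<bar> \<le> 1 \<and> (\<forall>j<Suc n. arrow_row (x i) (y i) j = (if j = k then a else 0))"
    proof -
      consider "x i \<ge> Suc n" "y i \<ge> Suc n" | "x i \<ge> Suc n" "y i < Suc n" | "x i < Suc n" "y i \<ge> Suc n"
        using out by linarith
      then show ?thesis
      proof cases
        case 1
        then show ?thesis by (intro exI[of _ 0]) (auto simp: arrow_row_def)
      next
        case 2
        then show ?thesis
          by (intro exI[of _ "y i"] conjI exI[of _ "-1"]) (auto simp: arrow_row_def)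
      next
        case 3
        then show ?thesis
          by (intro exI[of _ "x i"] conjI exI[of _ "1"]) (auto simp: arrow_row_def)
      qed
    qed
    then obtain k a where k: "k < Suc n" and a: "\<bar>a\<bar> \<le> 1"
      and row: "\<And>j. j < Suc n \<Longrightarrow> arrow_row (x i) (y i) j = (if j = k then a else 0)"
      by blast
    \<comment> \<open>In the minor the removed column \<open>k\<close> joins the deleted vertex: it
      is renamed to \<open>n\<close>, which is out of range there. Indices that were out of range
      stay so.\<close>
    define del where "del = (\<lambda>z. if z = k then n else if z > k then z - 1 else z)"
    define ins where "ins = (\<lambda>m. if m < i then m else Suc m)"
    have minor: "mat_delete A i k =
        Matrix.mat n n (\<lambda>(i', j'). arrow_row (del (x (ins i'))) (del (y (ins i'))) j')"
    proof (rule eq_matI)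
      fix i' j'
      assume "i' < dim_row (Matrix.mat n n (\<lambda>(i', j'). arrow_row (del (x (ins i'))) (del (y (ins i'))) j'))"
        and "j' < dim_col (Matrix.mat n n (\<lambda>(i', j'). arrow_row (del (x (ins i'))) (del (y (ins i'))) j'))"
      then have ij: "i' < n" "j' < n" by simp_all
      have shift: "(if j' < k then j' else Suc j') = z \<longleftrightarrow> j' = del z" for z
        using ij k by (auto simp: del_def)
      show "mat_delete A i k $$ (i', j') =
          Matrix.mat n n (\<lambda>(i', j'). arrow_row (del (x (ins i'))) (del (y (ins i'))) j') $$ (i', j')"
        using ij by (simp add: mat_delete_def A_def arrow_row_def shift[symmetric] ins_def)
    qed (simp_all add: A_def)
    have "Determinant.det A = (\<Sum>j<Suc n. A $$ (i, j) * cofactor A i j)"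
      by (rule laplace_expansion_row[OF A i])
    also have "\<dots> = (\<Sum>j<Suc n. if j = k then a * cofactor A i j else 0)"
      by (rule sum.cong) (use i row in \<open>auto simp: A_def\<close>)
    also have "\<dots> = a * cofactor A i k"
      using k by (simp add: sum.delta del: sum.lessThan_Suc)
    finally have "\<bar>Determinant.det A\<bar> = \<bar>a\<bar> * \<bar>Determinant.det (mat_delete A i k)\<bar>"
      by (simp add: cofactor_def abs_mult power_abs)
    also have "\<dots> \<le> 1 * 1"
      using a Suc.IH[of "\<lambda>i. del (x (ins i))" "\<lambda>i. del (y (ins i))"] unfolding minor
      by (intro mult_mono) auto
    finally show ?thesis by (simp add: A_def)
  qed
qed

text \<open>Multilinearity in all rows at once: in each term of the Leibniz formula the product of
  sums expands over the set \<open>X\<close> of rows that contribute their \<open>f\<close>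
  part.\<close>

lemma det_add_rows:
  fixes f g :: "nat \<Rightarrow> nat \<Rightarrow> 'a::comm_ring_1"
  shows "Determinant.det (Matrix.mat n n (\<lambda>(i, j). f i j + g i j)) =
    (\<Sum>X\<in>Pow {0..<n}. Determinant.det (Matrix.mat n n (\<lambda>(i, j). if i \<in> X then f i j else g i j)))"
proof -
  let ?P = "{\<pi>. \<pi> permutes {0..<n}}"
  have split: "(\<Prod>i\<in>X. f i (\<pi> i)) * (\<Prod>i\<in>{0..<n}-X. g i (\<pi> i)) =
      (\<Prod>i = 0..<n. if i \<in> X then f i (\<pi> i) else g i (\<pi> i))"
    if "X \<in> Pow {0..<n}" for X \<pi>
  proof -
    have "{0..<n} \<inter> X = X" "{0..<n} \<inter> - X = {0..<n} - X" using that by auto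
    then show ?thesis
      by (simp add: prod.If_cases[where P = "\<lambda>i. i \<in> X", simplified])
  qed
  have entry: "(\<Prod>i = 0..<n. Matrix.mat n n (\<lambda>(i, j). h i j) $$ (i, \<pi> i)) = (\<Prod>i = 0..<n. h i (\<pi> i))"
    if "\<pi> permutes {0..<n}" for \<pi> and h :: "nat \<Rightarrow> nat \<Rightarrow> 'a"
    by (rule prod.cong) (use that permutes_in_image in \<open>fastforce+\<close>)
  have det_eq: "Determinant.det (Matrix.mat n n (\<lambda>(i, j). h i j)) =
      (\<Sum>\<pi>\<in>?P. signof \<pi> * (\<Prod>i = 0..<n. h i (\<pi> i)))" for h :: "nat \<Rightarrow> nat \<Rightarrow> 'a"
    unfolding det_def'[OF mat_carrier] by (rule sum.cong) (simp_all add: entry)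
  have "Determinant.det (Matrix.mat n n (\<lambda>(i, j). f i j + g i j)) =
      (\<Sum>\<pi>\<in>?P. \<Sum>X\<in>Pow {0..<n}. signof \<pi> * (\<Prod>i = 0..<n. if i \<in> X then f i (\<pi> i) else g i (\<pi> i)))"
    unfolding det_eq by (intro sum.cong) (simp_all add: prod_add sum_distrib_left split)
  also have "\<dots> = (\<Sum>X\<in>Pow {0..<n}.
      Determinant.det (Matrix.mat n n (\<lambda>(i, j). if i \<in> X then f i j else g i j)))"
    unfolding det_eq by (rule sum.swap)
  finally show ?thesis .
qed

text \<open>Choosing one of the two arrows in every row gives an incidence matrix again, so each of
  the 2 ^ n terms of the expansion is at most 1 in absolute value.\<close>

lemma det_sum_of_arrow_rows_le:
  "\<bar>Determinant.det (Matrix.mat n n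
     (\<lambda>(i, j). arrow_row (x i) (y i) j + arrow_row (x' i) (y' i) j))\<bar> \<le> 2 ^ n"
proof -
  have "\<bar>Determinant.det (Matrix.mat n n
      (\<lambda>(i, j). arrow_row (x i) (y i) j + arrow_row (x' i) (y' i) j))\<bar> \<le>
      (\<Sum>X\<in>Pow {0..<n}. \<bar>Determinant.det (Matrix.mat n n
        (\<lambda>(i, j). if i \<in> X then arrow_row (x i) (y i) j else arrow_row (x' i) (y' i) j))\<bar>)"
    unfolding det_add_rows by (rule sum_abs)
  also have "\<dots> \<le> (\<Sum>X\<in>Pow {0..<n}. 1)"
  proof (rule sum_mono)
    fix X
    show "\<bar>Determinant.det (Matrix.mat n n
        (\<lambda>(i, j). if i \<in> X then arrow_row (x i) (y i) j else arrow_row (x' i) (y' i) j))\<bar> \<le> 1"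
    proof -
      have "(if i \<in> X then arrow_row (x i) (y i) j else arrow_row (x' i) (y' i) j) =
          arrow_row (if i \<in> X then x i else x' i) (if i \<in> X then y i else y' i) j" for i j
        by simp
      then show ?thesis by (simp only: det_arrow_rows_le_1)
    qed
  qed
  finally show ?thesis by (simp add: card_Pow)
qed

lemma det_cong_mod:
  fixes f g :: "nat \<Rightarrow> nat \<Rightarrow> int"
  assumes "\<And>i j. i < n \<Longrightarrow> j < n \<Longrightarrow> [f i j = g i j] (mod m)"
  shows "[Determinant.det (Matrix.mat n n (\<lambda>(i, j). f i j)) =
    Determinant.det (Matrix.mat n n (\<lambda>(i, j). g i j))] (mod m)"
  unfolding det_def'[OF mat_carrier]
proof (intro cong_sum cong_mult cong_prod cong_refl)
  fix \<pi> i assume "\<pi> \<in> {\<pi>. \<pi> permutes {0..<n}}" "i \<in> {0..<n}"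
  then have "i < n" "\<pi> i < n" using permutes_in_image by fastforce+
  then show "[Matrix.mat n n (\<lambda>(i, j). f i j) $$ (i, \<pi> i) =
      Matrix.mat n n (\<lambda>(i, j). g i j) $$ (i, \<pi> i)] (mod m)"
    using assms by simp
qed

text \<open>Multiplying by the adjugate turns a kernel vector modulo \<open>p\<close> into the
  divisibility of det * c k by \<open>p\<close>, without leaving the integers.\<close>

lemma dvd_det_of_kernel_vector:
  fixes f :: "nat \<Rightarrow> nat \<Rightarrow> int"
  assumes "prime p" and k: "k < n" "\<not> p dvd c k"
    and ker: "\<And>i. i < n \<Longrightarrow> p dvd (\<Sum>j<n. f i j * c j)"
  shows "p dvd Determinant.det (Matrix.mat n n (\<lambda>(i, j). f i j))"
proof -
  define A where "A = Matrix.mat n n (\<lambda>(i, j). f i j)"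
  have A: "A \<in> carrier_mat n n" by (simp add: A_def)
  define v where "v = Matrix.vec n c"
  have v: "v \<in> carrier_vec n" by (simp add: v_def)
  have Av: "vec_index (A *\<^sub>v v) i = (\<Sum>j<n. f i j * c j)" if "i < n" for i
    using that by (simp add: A_def v_def scalar_prod_def lessThan_atLeast0)
  have "(Determinant.det A \<cdot>\<^sub>m 1\<^sub>m n) *\<^sub>v v = adj_mat A *\<^sub>v (A *\<^sub>v v)"
    using adj_mat[OF A] assoc_mult_mat_vec[OF adj_mat(1)[OF A] A v] by simp
  moreover have "vec_index ((Determinant.det A \<cdot>\<^sub>m 1\<^sub>m n) *\<^sub>v v) k = Determinant.det A * c k"
    using k by (simp add: v_def scalar_prod_def if_distrib[of "\<lambda>z. z * _"] if_distrib[of "\<lambda>z. _ * z"] cong: if_cong)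
  moreover have "vec_index (adj_mat A *\<^sub>v (A *\<^sub>v v)) k = (\<Sum>i<n. adj_mat A $$ (k, i) * (\<Sum>j<n. f i j * c j))"
    using k adj_mat(1)[OF A] A Av by (simp add: scalar_prod_def lessThan_atLeast0)
  ultimately have "Determinant.det A * c k = (\<Sum>i<n. adj_mat A $$ (k, i) * (\<Sum>j<n. f i j * c j))"
    by simp
  moreover have "p dvd \<dots>" by (rule dvd_sum, rule dvd_mult) (use ker in auto)
  ultimately have "p dvd Determinant.det A * c k" by simp
  then show ?thesis using assms(1) k(2) unfolding A_def by (simp add: prime_dvd_mult_iff)
qed


section \<open>Midpoint relations along a spanning tree\<close>

text \<open>The indices are the vertices of a rooted tree numbered so that parents precede children;
  \<open>lab i\<close> is the midpoint of the edge from \<open>par i\<close> to \<open>i\<close> and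
  may be any vertex, before or after \<open>i\<close>.\<close>

lemma prime_lt_two_power_of_midpoint_relations:
  fixes v :: "nat \<Rightarrow> int" and par lab :: "nat \<Rightarrow> nat" and p :: int
  assumes "prime p" "odd p" "0 < m" and diff: "\<not> [v 1 = v 0] (mod p)"
    and par: "\<And>i. 0 < i \<Longrightarrow> i \<le> m \<Longrightarrow> par i < i"
    and lab: "\<And>i. 0 < i \<Longrightarrow> i \<le> m \<Longrightarrow> lab i \<le> m"
    and rel: "\<And>i. 0 < i \<Longrightarrow> i \<le> m \<Longrightarrow> [v (par i) + v i = 2 * v (lab i)] (mod p)"
  shows "p < 2 ^ m"
proof -
  \<comment> \<open>The root 0 is the deleted vertex: it is sent to \<open>m\<close>, just outside
    the columns 0..m-1.\<close>
  define col where "col = (\<lambda>z. if z = 0 then m else z - 1)"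
  have col: "j = col z \<longleftrightarrow> Suc j = z" if "j < m" for j z
    using that by (auto simp: col_def)
  define f where "f = (\<lambda>i j. arrow_row (col (Suc i)) (col (lab (Suc i))) j +
    arrow_row (col (par (Suc i))) (col (lab (Suc i))) j)"
  define D where "D = Determinant.det (Matrix.mat m m (\<lambda>(i, j). f i j))"
  have bound: "\<bar>D\<bar> \<le> 2 ^ m"
    unfolding D_def f_def by (rule det_sum_of_arrow_rows_le)
  have "p dvd D"
    unfolding D_def
  \<comment> \<open>The coefficients 1, 1, -2 of a relation sum to zero, so \<open>v\<close> may be
    shifted to vanish at the root. Coordinate 0 is then v 1 - v 0, which is nonzero modulo
    \<open>p\<close>.\<close>
  proof (rule dvd_det_of_kernel_vector[where c = "\<lambda>j. v (Suc j) - v 0" and k = 0])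
    have pick: "(\<Sum>j<m. of_bool (j = col z) * (v (Suc j) - v 0)) = v z - v 0" if "z \<le> m" for z
    proof -
      have "(\<Sum>j<m. of_bool (j = col z) * (v (Suc j) - v 0)) =
          (\<Sum>j<m. if j = col z then v (Suc j) - v 0 else 0)"
        by (rule sum.cong) auto
      also have "\<dots> = v z - v 0" using that by (auto simp: sum.delta col_def)
      finally show ?thesis .
    qed
    fix i assume i: "i < m"
    have "(\<Sum>j<m. f i j * (v (Suc j) - v 0)) = v (Suc i) + v (par (Suc i)) - 2 * v (lab (Suc i))"
      using i par[of "Suc i"] lab[of "Suc i"]
      by (simp add: f_def arrow_row_def algebra_simps sum.distrib sum_subtractf flip: sum_distrib_left)
         (use pick[of "Suc i"] pick[of "par (Suc i)"] pick[of "lab (Suc i)"] in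
           \<open>simp add: algebra_simps sum_subtractf flip: sum_distrib_left\<close>)
    then show "p dvd (\<Sum>j<m. f i j * (v (Suc j) - v 0))"
      using rel[of "Suc i"] i by (simp add: cong_iff_dvd_diff add.commute)
  qed (use assms in \<open>auto simp: cong_iff_dvd_diff\<close>)
  have "odd D"
  proof -
    \<comment> \<open>Modulo 2 the label terms, the only ones that could lie above the diagonal,
      disappear; parents preceding children makes the rest lower triangular.\<close>
    define g :: "nat \<Rightarrow> nat \<Rightarrow> int" where
      "g = (\<lambda>i j. of_bool (j = i) + of_bool (Suc j = par (Suc i)))"
    let ?G = "Matrix.mat m m (\<lambda>(i, j). g i j)"
    have "[f i j = g i j] (mod 2)" if "i < m" "j < m" for i j
      using that by (simp add: f_def g_def arrow_row_def col cong_iff_dvd_diff)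
    then have "[D = Determinant.det ?G] (mod 2)"
      unfolding D_def by (rule det_cong_mod)
    also have "Determinant.det ?G = prod_list (diag_mat ?G)"
    proof (rule det_lower_triangular[where n = m])
      fix i j assume "i < j" "j < m"
      then show "?G $$ (i, j) = 0" using par[of "Suc i"] by (auto simp: g_def)
    qed simp
    also have "diag_mat ?G = replicate m 1"
    proof (rule nth_equalityI)
      fix i assume "i < length (diag_mat ?G)"
      then show "diag_mat ?G ! i = replicate m 1 ! i"
        using par[of "Suc i"] by (auto simp: diag_mat_def g_def)
    qed (simp add: diag_mat_def)
    finally show ?thesis by (simp add: cong_def odd_iff_mod_2_eq_one)
  qed
  then have "D \<noteq> 0" by auto
  with \<open>p dvd D\<close> have "p \<le> \<bar>D\<bar>" using zdvd_imp_le[of p "\<bar>D\<bar>"] by simp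
  with bound have "p \<le> 2 ^ m" by simp
  moreover have "p \<noteq> 2 ^ m" using \<open>odd p\<close> \<open>0 < m\<close> by auto
  ultimately show ?thesis by simp
qed

text \<open>Greedy growth of a spanning tree: an initial segment different from \<open>W\<close>
  cannot be closed under \<open>R\<close>, since paths lead from \<open>v 0\<close> to everything,
  so some arrow leaves it and its head is the next vertex.\<close>

lemma enumerate_connected:
  assumes "finite W" "W \<noteq> {}" and R: "R \<subseteq> W \<times> W"
    and conn: "\<And>x y. x \<in> W \<Longrightarrow> y \<in> W \<Longrightarrow> (x, y) \<in> R\<^sup>*"
    and "k < card W"
  shows "\<exists>v. inj_on v {..k} \<and> v ` {..k} \<subseteq> W \<and> (\<forall>i. 0 < i \<and> i \<le> k \<longrightarrow> (\<exists>j<i. (v j, v i) \<in> R))"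
  using \<open>k < card W\<close>
proof (induction k)
  case 0
  obtain x where "x \<in> W" using \<open>W \<noteq> {}\<close> by auto
  then show ?case by (intro exI[of _ "\<lambda>_. x"]) auto
next
  case (Suc k)
  then obtain v where v: "inj_on v {..k}" "v ` {..k} \<subseteq> W"
    and par: "\<And>i. 0 < i \<Longrightarrow> i \<le> k \<Longrightarrow> \<exists>j<i. (v j, v i) \<in> R"
    by auto
  have "card (v ` {..k}) < card W" using v(1) Suc.prems by (simp add: card_image)
  then obtain y where y: "y \<in> W" "y \<notin> v ` {..k}" using v(2) by (metis subset_antisym less_irrefl subsetI)
  have "(v 0, y) \<in> R\<^sup>*" using v(2) y by (intro conn) auto
  then have "\<not> R `` (v ` {..k}) \<subseteq> v ` {..k}"
    using y(2) Image_closed_trancl[of R "v ` {..k}"] by blast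
  then obtain j z where j: "j \<le> k" and z: "(v j, z) \<in> R" "z \<notin> v ` {..k}" by auto
  let ?v = "v(Suc k := z)"
  have img: "?v ` {..Suc k} = insert z (v ` {..k})"
    by (auto simp: atMost_Suc)
  have "inj_on ?v {..Suc k}"
    using v(1) z(2) by (auto simp: inj_on_def atMost_Suc)
  moreover have "?v ` {..Suc k} \<subseteq> W" unfolding img using v(2) z(1) R by auto
  moreover have "\<exists>j<i. (?v j, ?v i) \<in> R" if "0 < i" "i \<le> Suc k" for i
  proof (cases "i = Suc k")
    case True
    then show ?thesis using j z(1) by (intro exI[of _ j]) auto
  next
    case False
    then obtain j where "j < i" "(v j, v i) \<in> R" using par[of i] \<open>0 < i\<close> \<open>i \<le> Suc k\<close> by auto
    then show ?thesis using False \<open>i \<le> Suc k\<close> by (intro exI[of _ j]) auto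
  qed
  ultimately show ?case by blast
qed

text \<open>The enumeration exhausts \<open>W\<close>, so every midpoint is itself an enumerated
  vertex and each relation involves only the unknowns at hand. Distinct elements of \<open>W\<close>
  are incongruent because they are reduced residues.\<close>

lemma prime_lt_two_power_card:
  fixes W :: "int set" and p :: int
  assumes "prime p" "odd p" and W: "finite W" "W \<subseteq> {0..<p}" "2 \<le> card W"
    and R: "R \<subseteq> W \<times> W"
    and conn: "\<And>x y. x \<in> W \<Longrightarrow> y \<in> W \<Longrightarrow> (x, y) \<in> R\<^sup>*"
    and mid: "\<And>x y. (x, y) \<in> R \<Longrightarrow> \<exists>z\<in>W. [x + y = 2 * z] (mod p)"
  shows "p < 2 ^ (card W - 1)"
proof -
  define m where "m = card W - 1"
  have m: "0 < m" "card W = Suc m" using W(3) by (auto simp: m_def)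
  obtain v where v: "inj_on v {..m}" "v ` {..m} \<subseteq> W"
    and "\<forall>i. 0 < i \<and> i \<le> m \<longrightarrow> (\<exists>j<i. (v j, v i) \<in> R)"
    using enumerate_connected[OF W(1) _ R conn, of m] m by fastforce
  then obtain par where par: "\<And>i. 0 < i \<Longrightarrow> i \<le> m \<Longrightarrow> par i < i \<and> (v (par i), v i) \<in> R"
    by metis
  have onto: "v ` {..m} = W"
    using v W(1) m(2) by (intro card_subset_eq) (auto simp: card_image)
  have "\<exists>l\<le>m. [v (par i) + v i = 2 * v l] (mod p)" if "0 < i" "i \<le> m" for i
    using mid[of "v (par i)" "v i"] par[OF that] onto by blast
  then obtain lab where lab: "\<And>i. 0 < i \<Longrightarrow> i \<le> m \<Longrightarrow>
      lab i \<le> m \<and> [v (par i) + v i = 2 * v (lab i)] (mod p)"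
    by metis
  have "v 1 \<noteq> v 0" using v(1) m(1) by (auto simp: inj_on_def)
  moreover have "v 1 \<in> W" "v 0 \<in> W" using v(2) m(1) by auto
  then have "v 1 \<in> {0..<p}" "v 0 \<in> {0..<p}" using W(2) by blast+
  ultimately have "\<not> [v 1 = v 0] (mod p)" by (auto simp: cong_def)
  then show ?thesis
    using prime_lt_two_power_of_midpoint_relations[OF assms(1,2) m(1), of v par lab] par lab
    by (simp add: m_def)
qed

section \<open>Palette graphs of midpoint relations\<close>

lemma sum_class_cong: "[b = c] (mod int p) \<Longrightarrow> sum_class p S b = sum_class p S c"
  by (simp add: sum_class_def cong_def)

text \<open>A class determines its sum only when it is nonempty: all non-sums share the empty class.
  Hence the representation of \<open>b\<close> among the hypotheses.\<close>

lemma sum_class_eqD: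
  assumes "sum_class p S b = sum_class p S c" "a1 \<in> S" "a2 \<in> S" "[b = a1 + a2] (mod int p)"
  shows "[b = c] (mod int p)"
proof -
  have "{#a1, a2#} \<in> sum_class p S b"
    using assms(2-4) by (auto simp: sum_class_def two_multisets_def cong_def)
  then have "[a1 + a2 = c] (mod int p)"
    unfolding assms(1) by (simp add: sum_class_def)
  then show ?thesis using assms(4) by (rule cong_trans[rotated])
qed

text \<open>The interface between algebra and topology. \<open>B\<close> plays the arc colours and
  \<open>R\<close> the pairs of under-arcs at crossings, with a1, ..., a4 the surrounding colours
  and \<open>d\<close> the over-arc. Adding up gives b + c = (a1 + a3) + (a2 + a4) = 2 d, so the
  label of the edge is the class of \<open>d\<close>.\<close>

lemma R_subgraph_of_connected_sums:
  fixes p :: nat and S B :: "int set"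
  assumes p: "prime p" "odd p" and B: "B \<subseteq> Zmod p" "2 \<le> card B"
    and sums: "\<And>b. b \<in> B \<Longrightarrow> \<exists>a1\<in>S. \<exists>a2\<in>S. [b = a1 + a2] (mod int p)"
    and R: "\<And>b c. (b, c) \<in> R \<Longrightarrow> b \<in> B \<and> c \<in> B \<and> b \<noteq> c \<and>
      (\<exists>a1\<in>S. \<exists>a2\<in>S. \<exists>a3\<in>S. \<exists>a4\<in>S. [b = a1 + a2] (mod int p) \<and> [c = a3 + a4] (mod int p) \<and>
         [a1 + a3 = a2 + a4] (mod int p) \<and> (\<exists>d\<in>B. [d = a1 + a3] (mod int p)))"
    and conn: "\<And>x y. x \<in> B \<Longrightarrow> y \<in> B \<Longrightarrow> (x, y) \<in> R\<^sup>*"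
  shows "\<exists>V E. R_subgraph p S V E \<and> connected_graph V E \<and>
           int (card V) \<ge> \<lfloor>log 2 (real p)\<rfloor> + 2"
proof -
  let ?cl = "sum_class p S"
  define V where "V = ?cl ` B"
  define E where "E = {{?cl b, ?cl c} | b c. (b, c) \<in> R}"
  have RB: "R \<subseteq> B \<times> B" using R by auto
  have mid: "\<exists>d\<in>B. [b + c = 2 * d] (mod int p)" if bc: "(b, c) \<in> R" for b c
  proof -
    obtain a1 a2 a3 a4 d where h: "[b = a1 + a2] (mod int p)" "[c = a3 + a4] (mod int p)"
      "[a1 + a3 = a2 + a4] (mod int p)" "d \<in> B" "[d = a1 + a3] (mod int p)"
      using R[OF bc] by blast
    have "[b + c = (a1 + a2) + (a3 + a4)] (mod int p)" using h by (intro cong_add)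
    moreover have "[(a1 + a3) + (a2 + a4) = d + d] (mod int p)"
      by (intro cong_add cong_sym[OF h(5)] cong_trans[OF cong_sym[OF h(3)] cong_sym[OF h(5)]])
    ultimately have "[b + c = 2 * d] (mod int p)" by (simp add: cong_def algebra_simps)
    with h(4) show ?thesis by blast
  qed
  have inj: "inj_on ?cl B"
  proof (rule inj_onI)
    fix b c assume bc: "b \<in> B" "c \<in> B" "?cl b = ?cl c"
    obtain a1 a2 where "a1 \<in> S" "a2 \<in> S" "[b = a1 + a2] (mod int p)" using sums[OF bc(1)] by blast
    then have "[b = c] (mod int p)" by (rule sum_class_eqD[OF bc(3)])
    moreover have "b \<in> {0..<int p}" "c \<in> {0..<int p}" using bc B(1) by (auto simp: Zmod_def)
    ultimately show "b = c" by (simp add: cong_def)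
  qed
  have V: "V \<subseteq> palette_vertices p S"
    using sums sum_class_cong unfolding V_def palette_vertices_eq by blast
  have "E \<subseteq> palette_edges p S"
  proof
    fix e assume "e \<in> E"
    then obtain b c where e: "e = {?cl b, ?cl c}" and bc: "(b, c) \<in> R" by (auto simp: E_def)
    from R[OF bc] obtain a1 a2 a3 a4 where h: "b \<in> B" "c \<in> B" "b \<noteq> c" "a1 \<in> S" "a2 \<in> S" "a3 \<in> S" "a4 \<in> S"
      "[b = a1 + a2] (mod int p)" "[c = a3 + a4] (mod int p)" "[a1 + a3 = a2 + a4] (mod int p)"
      by blast
    have "{#a1, a2#} \<in> ?cl b" "{#a3, a4#} \<in> ?cl c"
      using h by (auto simp: sum_class_def two_multisets_def cong_def)
    moreover have "?cl b \<noteq> ?cl c" using inj h(1-3) by (auto dest: inj_onD)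
    moreover have "?cl b \<in> palette_vertices p S" "?cl c \<in> palette_vertices p S"
      using V h(1,2) by (auto simp: V_def)
    ultimately show "e \<in> palette_edges p S"
      unfolding palette_edges_def e using h(10)
      by (intro CollectI exI[of _ "?cl b"] exI[of _ "?cl c"] conjI exI[of _ a1] exI[of _ a2]
        exI[of _ a3] exI[of _ a4] disjI1 refl)
  qed
  moreover have "\<forall>e\<in>E. e \<subseteq> V" using RB by (auto simp: E_def V_def)
  \<comment> \<open>The label condition ranges over all integer representatives b1, b2 and both
    orders of the pair; their sum is still congruent to b + c.\<close>
  moreover have "edge_label p S b1 b2 \<in> V" if "{?cl b1, ?cl b2} \<in> E" for b1 b2
  proof -
    from that obtain b c where bc: "(b, c) \<in> R" "{?cl b1, ?cl b2} = {?cl b, ?cl c}" by (auto simp: E_def)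
    have "b \<in> B" "c \<in> B" using RB bc(1) by blast+
    have eq: "[x = b1] (mod int p)" if "?cl b1 = ?cl x" "x \<in> {b, c}" for x b1
    proof -
      from that \<open>b \<in> B\<close> \<open>c \<in> B\<close> obtain a1 a2 where "a1 \<in> S" "a2 \<in> S" "[x = a1 + a2] (mod int p)"
        using sums[of x] by blast
      then show ?thesis by (rule sum_class_eqD[OF that(1)[symmetric]])
    qed
    have "[b + c = b1 + b2] (mod int p)"
    proof -
      consider "?cl b1 = ?cl b" "?cl b2 = ?cl c" | "?cl b1 = ?cl c" "?cl b2 = ?cl b"
        using bc(2) unfolding doubleton_eq_iff by blast
      then show ?thesis
      proof cases
        case 1
        then show ?thesis by (intro cong_add eq) simp_all
      next
        case 2
        then have "[c + b = b1 + b2] (mod int p)" by (intro cong_add eq) simp_all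
        then show ?thesis by (simp add: add.commute)
      qed
    qed
    moreover obtain d where d: "d \<in> B" "[b + c = 2 * d] (mod int p)" using mid bc(1) by blast
    ultimately have "[b1 + b2 = 2 * d] (mod int p)" by (simp add: cong_def)
    then have "[modular_inverse (int p) 2 * (b1 + b2) = modular_inverse (int p) 2 * (2 * d)] (mod int p)"
      by (rule cong_mult[OF cong_refl])
    moreover have "[(2 * modular_inverse (int p) 2) * d = 1 * d] (mod int p)"
      using p by (intro cong_mult cong_modular_inverse1 cong_refl) simp_all
    ultimately have "[modular_inverse (int p) 2 * (b1 + b2) = d] (mod int p)"
      by (simp add: cong_def ac_simps)
    then have "edge_label p S b1 b2 = ?cl d"
      unfolding edge_label_def by (rule sum_class_cong)
    then show ?thesis using d(1) by (simp add: V_def)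
  qed
  ultimately have sub: "R_subgraph p S V E"
    using V by (auto simp: R_subgraph_def subgraph_of_def)
  have path: "(?cl x, ?cl y) \<in> {(a, b). {a, b} \<in> E}\<^sup>*" if "(x, y) \<in> R\<^sup>*" for x y
    using that
  proof (induction rule: rtrancl_induct)
    case (step y z)
    then have "(?cl y, ?cl z) \<in> {(a, b). {a, b} \<in> E}" by (auto simp: E_def)
    with step.IH show ?case by (rule rtrancl.rtrancl_into_rtrancl)
  qed simp
  have "B \<noteq> {}" using B(2) by auto
  then have con: "connected_graph V E"
    using path conn by (auto simp: connected_graph_def V_def)
  have "finite B" using B(2) card.infinite by fastforce
  have "int p < 2 ^ (card B - 1)"
  proof (rule prime_lt_two_power_card[where R = R])
    show "R \<subseteq> B \<times> B" by (rule RB)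
    show "(x, y) \<in> R\<^sup>*" if "x \<in> B" "y \<in> B" for x y using that by (rule conn)
    show "\<exists>z\<in>B. [x + y = 2 * z] (mod int p)" if "(x, y) \<in> R" for x y using that by (rule mid)
  qed (use p B \<open>finite B\<close> in \<open>simp_all add: Zmod_def\<close>)
  then have "real p < 2 ^ (card B - 1)" by (metis of_int_less_iff of_int_of_nat_eq of_int_power of_int_numeral)
  moreover have "0 < real p" using p(1) by (simp add: prime_gt_0_nat)
  ultimately have "log 2 (real p) < real (card B - 1)"
    by (simp add: log_less_iff powr_realpow)
  \<comment> \<open>Strictness makes \<open>card B - 1\<close> at least one more than the floor,
    which yields the summand 2.\<close>
  then have "\<lfloor>log 2 (real p)\<rfloor> < int (card B - 1)" by (simp add: floor_less_iff)
  moreover have "card V = card B" unfolding V_def by (rule card_image[OF inj])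
  ultimately have "int (card V) \<ge> \<lfloor>log 2 (real p)\<rfloor> + 2" using B(2) by linarith
  with sub con show ?thesis by blast
qed

section \<open>Regions near a strand and near a crossing\<close>

text \<open>The determinant of the pair (a, b): positive exactly when \<open>b\<close> points to the
  left of \<open>a\<close>.\<close>

definition cross :: "complex \<Rightarrow> complex \<Rightarrow> real" where
  "cross a b = Im (cnj a * b)"

lemma cross_simps [simp]:
  "cross a 0 = 0" "cross a a = 0" "cross a (- b) = - cross a b" "cross (- a) b = - cross a b"
  by (simp_all add: cross_def)

lemma cross_swap: "cross b a = - cross a b"
  by (simp add: cross_def)

lemma bounded_linear_cross: "bounded_linear (cross a)"
  unfolding cross_def
  by (intro bounded_linear_compose[OF bounded_linear_Im] bounded_linear_mult_right)

lemma cross_eq_0_imp_span: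
  assumes "cross a b = 0" "a \<noteq> 0"
  shows "b \<in> span {a}"
proof -
  have "cnj a * b = of_real (Re (cnj a * b))"
    using assms(1) by (simp add: cross_def complex_eq_iff)
  then have "a * cnj a * b = of_real (Re (cnj a * b)) * a" by (simp add: ac_simps)
  moreover have "a * cnj a = of_real ((norm a)\<^sup>2)" by (rule complex_norm_square[symmetric])
  ultimately have "of_real ((norm a)\<^sup>2) * b = of_real (Re (cnj a * b)) * a" by simp
  then have "b = (Re (cnj a * b) / (norm a)\<^sup>2) *\<^sub>R a"
    using assms(2) by (simp add: scaleR_conv_of_real field_simps)
  then show ?thesis by (metis span_base span_scale singletonI)
qed

text \<open>Cramer's rule: the coordinates in the basis (a, b) are quotients of
  determinants.\<close>

lemma dual_basis:
  assumes "cross a b \<noteq> 0"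
  obtains f g where "bounded_linear f" "bounded_linear g"
    "f a = (1::real)" "f b = 0" "g a = (0::real)" "g b = 1"
proof
  show "bounded_linear (\<lambda>q. cross b q / cross b a)" "bounded_linear (\<lambda>q. cross a q / cross a b)"
    by (intro bounded_linear_compose[OF bounded_linear_divide bounded_linear_cross])+
qed (use assms in \<open>simp_all add: cross_swap[of b a]\<close>)

text \<open>The strict derivative at 0. Both points vary, which an ordinary derivative does not
  allow; this is what stops a transversal segment that starts on the strand near 0 from meeting the
  strand again.\<close>

definition strictly_differentiable :: "(real \<Rightarrow> complex) \<Rightarrow> complex \<Rightarrow> bool" where
  "strictly_differentiable \<alpha> a \<longleftrightarrow> (\<forall>\<epsilon>>0. \<exists>\<delta>>0. \<forall>s t. \<bar>s\<bar> < \<delta> \<and> \<bar>t\<bar> < \<delta> \<longrightarrow>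
     norm (\<alpha> s - \<alpha> t - (s - t) *\<^sub>R a) \<le> \<epsilon> * \<bar>s - t\<bar>)"

lemma strictly_differentiable_reverse:
  assumes "strictly_differentiable \<alpha> a"
  shows "strictly_differentiable (\<lambda>h. \<alpha> (- h)) (- a)"
  unfolding strictly_differentiable_def
proof (intro allI impI)
  fix \<epsilon> :: real assume "\<epsilon> > 0"
  then obtain \<delta> where "\<delta> > 0" and \<delta>: "\<And>s t. \<bar>s\<bar> < \<delta> \<Longrightarrow> \<bar>t\<bar> < \<delta> \<Longrightarrow>
      norm (\<alpha> s - \<alpha> t - (s - t) *\<^sub>R a) \<le> \<epsilon> * \<bar>s - t\<bar>"
    using assms unfolding strictly_differentiable_def by blast
  have "norm (\<alpha> (- s) - \<alpha> (- t) - (s - t) *\<^sub>R - a) \<le> \<epsilon> * \<bar>s - t\<bar>" if "\<bar>s\<bar> < \<delta>" "\<bar>t\<bar> < \<delta>" for s t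
    using \<delta>[of "- s" "- t"] that by (simp add: algebra_simps abs_minus_commute)
  with \<open>\<delta> > 0\<close> show "\<exists>\<delta>>0. \<forall>s t. \<bar>s\<bar> < \<delta> \<and> \<bar>t\<bar> < \<delta> \<longrightarrow>
      norm (\<alpha> (- s) - \<alpha> (- t) - (s - t) *\<^sub>R - a) \<le> \<epsilon> * \<bar>s - t\<bar>"
    by blast
qed

lemma strictly_differentiable_linear:
  fixes f :: "complex \<Rightarrow> real"
  assumes "strictly_differentiable \<alpha> a" "bounded_linear f" "\<epsilon> > 0"
  shows "\<exists>\<delta>>0. \<forall>s t. \<bar>s\<bar> < \<delta> \<longrightarrow> \<bar>t\<bar> < \<delta> \<longrightarrow> \<bar>f (\<alpha> s - \<alpha> t) - (s - t) * f a\<bar> \<le> \<epsilon> * \<bar>s - t\<bar>"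
proof -
  interpret f: bounded_linear f by fact
  obtain K where K: "K > 0" "\<And>q. \<bar>f q\<bar> \<le> norm q * K"
    using f.pos_bounded by auto
  obtain \<delta> where "\<delta> > 0" and \<delta>: "\<And>s t. \<bar>s\<bar> < \<delta> \<Longrightarrow> \<bar>t\<bar> < \<delta> \<Longrightarrow>
      norm (\<alpha> s - \<alpha> t - (s - t) *\<^sub>R a) \<le> \<epsilon> / K * \<bar>s - t\<bar>"
    using assms(1)[unfolded strictly_differentiable_def, rule_format, OF divide_pos_pos[OF assms(3) K(1)]]
    by blast
  have "\<bar>f (\<alpha> s - \<alpha> t) - (s - t) * f a\<bar> \<le> \<epsilon> * \<bar>s - t\<bar>" if "\<bar>s\<bar> < \<delta>" "\<bar>t\<bar> < \<delta>" for s t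
  proof -
    have "\<bar>f (\<alpha> s - \<alpha> t) - (s - t) * f a\<bar> = \<bar>f (\<alpha> s - \<alpha> t - (s - t) *\<^sub>R a)\<bar>"
      by (simp add: f.diff f.scaleR)
    also have "\<dots> \<le> norm (\<alpha> s - \<alpha> t - (s - t) *\<^sub>R a) * K" by (rule K(2))
    also have "\<dots> \<le> \<epsilon> / K * \<bar>s - t\<bar> * K"
      using \<delta>[OF that] K(1) by (intro mult_right_mono) auto
    finally show ?thesis using K(1) by simp
  qed
  with \<open>\<delta> > 0\<close> show ?thesis by blast
qed

lemma strictly_differentiable_near:
  assumes "strictly_differentiable \<alpha> a" "0 < r"
  shows "\<exists>\<delta>>0. \<forall>h e. \<bar>h\<bar> < \<delta> \<longrightarrow> \<bar>e\<bar> < \<delta> \<longrightarrow> \<alpha> h + e *\<^sub>R b \<in> ball (\<alpha> 0) r"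
proof -
  obtain \<delta> where "\<delta> > 0" and \<delta>: "\<And>s t. \<bar>s\<bar> < \<delta> \<Longrightarrow> \<bar>t\<bar> < \<delta> \<Longrightarrow>
      norm (\<alpha> s - \<alpha> t - (s - t) *\<^sub>R a) \<le> 1 * \<bar>s - t\<bar>"
    using assms(1)[unfolded strictly_differentiable_def, rule_format, of 1] by auto
  define M where "M = 1 + norm a + norm b"
  have "M > 0" by (simp add: M_def add_pos_nonneg)
  define \<delta>' where "\<delta>' = min \<delta> (r / M)"
  have "\<delta>' > 0" using \<open>\<delta> > 0\<close> \<open>M > 0\<close> \<open>0 < r\<close> by (simp add: \<delta>'_def)
  moreover have "\<alpha> h + e *\<^sub>R b \<in> ball (\<alpha> 0) r" if he: "\<bar>h\<bar> < \<delta>'" "\<bar>e\<bar> < \<delta>'" for h e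
  proof -
    have "\<alpha> h + e *\<^sub>R b - \<alpha> 0 = (\<alpha> h - \<alpha> 0 - (h - 0) *\<^sub>R a) + h *\<^sub>R a + e *\<^sub>R b"
      by simp
    then have "norm (\<alpha> h + e *\<^sub>R b - \<alpha> 0) \<le> norm (\<alpha> h - \<alpha> 0 - (h - 0) *\<^sub>R a) + norm (h *\<^sub>R a) + norm (e *\<^sub>R b)"
      by (metis norm_triangle_le norm_triangle_ineq add_right_mono)
    also have "\<dots> \<le> \<bar>h\<bar> + \<bar>h\<bar> * norm a + \<bar>e\<bar> * norm b"
      using \<delta>[of h 0] he \<open>\<delta> > 0\<close> by (simp add: \<delta>'_def)
    also have "\<dots> \<le> max \<bar>h\<bar> \<bar>e\<bar> + max \<bar>h\<bar> \<bar>e\<bar> * norm a + max \<bar>h\<bar> \<bar>e\<bar> * norm b"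
      by (intro add_mono mult_right_mono) auto
    also have "\<dots> = max \<bar>h\<bar> \<bar>e\<bar> * M" by (simp add: M_def algebra_simps)
    also have "\<dots> < \<delta>' * M" using he \<open>M > 0\<close> by (intro mult_strict_right_mono) auto
    also have "\<dots> \<le> r" using \<open>M > 0\<close> by (simp add: \<delta>'_def min_def field_simps)
    finally show ?thesis by (simp add: dist_norm norm_minus_commute)
  qed
  ultimately show ?thesis by blast
qed

text \<open>Near \<open>P\<close> the curve is nothing but the two short strands. A simple point is
  the case of two equal strands.\<close>

definition locally_covered ::
  "(real \<Rightarrow> complex) \<Rightarrow> (real \<Rightarrow> complex) \<Rightarrow> (real \<Rightarrow> complex) \<Rightarrow> complex \<Rightarrow> bool" where
  "locally_covered \<gamma> \<alpha> \<beta> P \<longleftrightarrow> (\<forall>\<delta>>0. \<exists>r>0. \<forall>t. \<gamma> t \<in> ball P r \<longrightarrow>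
     (\<exists>s. \<bar>s\<bar> < \<delta> \<and> (\<gamma> t = \<alpha> s \<or> \<gamma> t = \<beta> s)))"

section \<open>Connected sets that avoid the curve\<close>

lemma connected_subset_region:
  assumes "connected A" "A \<subseteq> - range \<gamma>" "x \<in> A"
  obtains R where "R \<in> regions \<gamma>" "A \<subseteq> R"
  using exists_component_superset[of A "- range \<gamma>"] assms unfolding regions_def by blast

lemma regions_eq: "R \<in> regions \<gamma> \<Longrightarrow> R' \<in> regions \<gamma> \<Longrightarrow> x \<in> R \<Longrightarrow> x \<in> R' \<Longrightarrow> R = R'"
  unfolding regions_def using components_nonoverlap by blast

lemma region_towards_unique:
  assumes "region_towards \<gamma> P w R" "region_towards \<gamma> P w R'"
  shows "R = R'"
proof -
  have "\<forall>\<^sub>F e in at_right (0::real). P + e *\<^sub>R w \<in> R \<and> P + e *\<^sub>R w \<in> R'"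
    using assms by (auto simp: region_towards_def intro: eventually_conj)
  then obtain e where "P + e *\<^sub>R w \<in> R" "P + e *\<^sub>R w \<in> R'"
    using eventually_happens trivial_limit_at_right_real by blast
  then show ?thesis using assms regions_eq by (auto simp: region_towards_def)
qed

text \<open>The function \<open>\<eta> * norm - l\<close> is sublinear, so this is an open convex
  cone with apex \<open>P\<close>; for \<open>\<eta> = 0\<close> it is a half-plane, or empty if
  \<open>l\<close> vanishes.\<close>

lemma convex_linear_pos:
  fixes l :: "complex \<Rightarrow> real"
  assumes "bounded_linear l" "\<eta> \<ge> 0"
  shows "convex {z. \<eta> * norm (z - P) < l (z - P)}"
proof (rule convexI)
  interpret bounded_linear l by fact
  fix x y and u v :: real
  assume "x \<in> {z. \<eta> * norm (z - P) < l (z - P)}" "y \<in> {z. \<eta> * norm (z - P) < l (z - P)}"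
    and uv: "0 \<le> u" "0 \<le> v" "u + v = 1"
  then have xy: "\<eta> * norm (x - P) < l (x - P)" "\<eta> * norm (y - P) < l (y - P)" by auto
  have eq: "u *\<^sub>R x + v *\<^sub>R y - P = u *\<^sub>R (x - P) + v *\<^sub>R (y - P)"
    using uv(3) by (simp add: algebra_simps flip: scaleR_add_left)
  have "\<eta> * norm (u *\<^sub>R (x - P) + v *\<^sub>R (y - P)) \<le> \<eta> * (u * norm (x - P) + v * norm (y - P))"
    using uv assms(2) norm_triangle_ineq[of "u *\<^sub>R (x - P)" "v *\<^sub>R (y - P)"]
    by (intro mult_left_mono) auto
  also have "\<dots> = u * (\<eta> * norm (x - P)) + v * (\<eta> * norm (y - P))" by (simp add: algebra_simps)
  also have "\<dots> < u * l (x - P) + v * l (y - P)"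
  proof (cases "u = 0")
    case True
    then show ?thesis using xy uv by simp
  next
    case False
    then show ?thesis using xy uv
      by (intro add_less_le_mono mult_strict_left_mono mult_left_mono) auto
  qed
  also have "\<dots> = l (u *\<^sub>R (x - P) + v *\<^sub>R (y - P))" by (simp add: add scaleR)
  finally show "u *\<^sub>R x + v *\<^sub>R y \<in> {z. \<eta> * norm (z - P) < l (z - P)}" by (simp add: eq)
qed

text \<open>Here (x, y) is the point of parameter \<open>h\<close> on the first strand, and raising
  it by \<open>e\<close> is supposed to hit the second strand at parameter \<open>s\<close>. Since x
  is at least 3h/4, the absolute value of \<open>s\<close> is at least 3h, so that of y + e is at
  least 9h/4; but it is at most h/4 + h = 5h/4.\<close>

lemma double_cones_disjoint:
  fixes x y e s h :: real
  assumes x: "\<bar>x\<bar> \<le> \<bar>s\<bar> / 4" and y: "\<bar>y + e - s\<bar> \<le> \<bar>s\<bar> / 4"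
    and h: "\<bar>x - h\<bar> \<le> \<bar>h\<bar> / 4" "\<bar>y\<bar> \<le> \<bar>h\<bar> / 4" "0 < e" "e \<le> h" shows False
proof -
  have "\<bar>h\<bar> = h" using h(3,4) by simp
  then have "x - h \<ge> - (h / 4)" "y \<le> h / 4" "- (h / 4) \<le> y"
    using abs_le_D1[OF h(2)] abs_le_D2[OF h(1)] abs_le_D2[OF h(2)] by simp_all
  moreover have "x \<le> \<bar>s\<bar> / 4" using abs_le_D1[OF x] .
  moreover have "y + e - s \<le> \<bar>s\<bar> / 4" "- (\<bar>s\<bar> / 4) \<le> y + e - s"
    using abs_le_D1[OF y] abs_le_D2[OF y] by simp_all
  moreover have "\<bar>s\<bar> = s \<or> \<bar>s\<bar> = - s" "\<bar>s\<bar> \<ge> 0" by (auto simp: abs_if)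
  moreover define a where "a = \<bar>s\<bar>"
  ultimately have *: "x - h \<ge> - (h / 4)" "y \<le> h / 4" "- (h / 4) \<le> y" "x \<le> a / 4" "y + e - s \<le> a / 4" "- (a / 4) \<le> y + e - s"
    and "a = s \<or> a = - s"  by simp_all
  from this(7) show False
  proof
    assume "a = s" then show False using * h(3,4) by linarith
  next
    assume "a = -s" then show False using * h(3,4) by linarith
  qed
qed

lemma abs_le_quarter: "\<bar>0 - x\<bar> \<le> 1/4 * \<bar>x\<bar> \<Longrightarrow> x = 0" for x :: real
  by linarith

text \<open>
  In the coordinates \<open>(x, y)\<close> of the basis \<open>(a, b)\<close>, the first strand lies in
  \<open>3 * \<bar>y\<bar> \<le> \<bar>x\<bar>\<close> and the second one in \<open>3 * \<bar>x\<bar> \<le> \<bar>y\<bar>\<close>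
  near the crossing. Hence the truncated convex cone \<open>x < 3 * y\<close>, \<open>y < 3 * x\<close> misses the
  curve, and so does the segment from \<open>\<alpha> h\<close> in the direction \<open>b\<close> until it reaches that cone.
\<close>

lemma crossing_sector_half:
  assumes \<alpha>: "\<alpha> 0 = P" "strictly_differentiable \<alpha> a"
    and \<beta>: "\<beta> 0 = P" "strictly_differentiable \<beta> b"
    and ab: "cross a b \<noteq> 0" and cover: "locally_covered \<gamma> \<alpha> \<beta> P"
  shows "\<exists>R. region_towards \<gamma> P (a + b) R \<and> (\<forall>\<^sub>F h in at_right 0. region_towards \<gamma> (\<alpha> h) b R)"
proof -
  obtain f g where fg: "bounded_linear f" "bounded_linear g"
    and base: "f a = (1::real)" "f b = 0" "g a = (0::real)" "g b = 1"
    using dual_basis[OF ab] .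
  interpret f: bounded_linear f by fact
  interpret g: bounded_linear g by fact
  \<comment> \<open>An error of a quarter of the parameter bounds the slope of a strand against its
    tangent by (1/4) / (3/4) = 1/3, which is the origin of the factor 3 in the cones.\<close>
  have q: "(1/4::real) > 0" by simp
  obtain d1 where "d1 > 0" and d1: "\<And>s t. \<bar>s\<bar> < d1 \<Longrightarrow> \<bar>t\<bar> < d1 \<Longrightarrow> \<bar>f (\<alpha> s - \<alpha> t) - (s - t) * f a\<bar> \<le> 1/4 * \<bar>s - t\<bar>"
    using strictly_differentiable_linear[OF \<alpha>(2) fg(1) q] by blast
  obtain d2 where "d2 > 0" and d2: "\<And>s t. \<bar>s\<bar> < d2 \<Longrightarrow> \<bar>t\<bar> < d2 \<Longrightarrow> \<bar>g (\<alpha> s - \<alpha> t) - (s - t) * g a\<bar> \<le> 1/4 * \<bar>s - t\<bar>"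
    using strictly_differentiable_linear[OF \<alpha>(2) fg(2) q] by blast
  obtain d3 where "d3 > 0" and d3: "\<And>s t. \<bar>s\<bar> < d3 \<Longrightarrow> \<bar>t\<bar> < d3 \<Longrightarrow> \<bar>f (\<beta> s - \<beta> t) - (s - t) * f b\<bar> \<le> 1/4 * \<bar>s - t\<bar>"
    using strictly_differentiable_linear[OF \<beta>(2) fg(1) q] by blast
  obtain d4 where "d4 > 0" and d4: "\<And>s t. \<bar>s\<bar> < d4 \<Longrightarrow> \<bar>t\<bar> < d4 \<Longrightarrow> \<bar>g (\<beta> s - \<beta> t) - (s - t) * g b\<bar> \<le> 1/4 * \<bar>s - t\<bar>"
    using strictly_differentiable_linear[OF \<beta>(2) fg(2) q] by blast
  note dpos = \<open>d1 > 0\<close> \<open>d2 > 0\<close> \<open>d3 > 0\<close> \<open>d4 > 0\<close>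
  define \<delta> where "\<delta> = min (min d1 d2) (min d3 d4)"
  have "\<delta> > 0" using dpos by (simp add: \<delta>_def)
  have \<alpha>': "\<bar>f (\<alpha> s - P) - s\<bar> \<le> \<bar>s\<bar> / 4" "\<bar>g (\<alpha> s - P)\<bar> \<le> \<bar>s\<bar> / 4" if "\<bar>s\<bar> < \<delta>" for s
    using d1[of s 0] d2[of s 0] that \<alpha>(1) dpos by (simp_all add: base \<delta>_def)
  have \<beta>': "\<bar>f (\<beta> s - P)\<bar> \<le> \<bar>s\<bar> / 4" "\<bar>g (\<beta> s - P) - s\<bar> \<le> \<bar>s\<bar> / 4" if "\<bar>s\<bar> < \<delta>" for s
    using d3[of s 0] d4[of s 0] that \<beta>(1) dpos by (simp_all add: base \<delta>_def)
  obtain r where "r > 0" and r: "\<And>t. \<gamma> t \<in> ball P r \<Longrightarrow> \<exists>s. \<bar>s\<bar> < \<delta> \<and> (\<gamma> t = \<alpha> s \<or> \<gamma> t = \<beta> s)"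
    using cover \<open>\<delta> > 0\<close> unfolding locally_covered_def by blast
  define K where "K = ball P r \<inter> {z. 0 < 3 * g (z - P) - f (z - P)} \<inter> {z. 0 < 3 * f (z - P) - g (z - P)}"
  have lin: "bounded_linear (\<lambda>q. 3 * g q - f q)" "bounded_linear (\<lambda>q. 3 * f q - g q)"
    using bounded_linear_sub[OF bounded_linear_const_mult[OF fg(2), of 3] fg(1)]
      bounded_linear_sub[OF bounded_linear_const_mult[OF fg(1), of 3] fg(2)] by simp_all
  have "convex {z. 0 < 3 * g (z - P) - f (z - P)}" "convex {z. 0 < 3 * f (z - P) - g (z - P)}"
    using lin[THEN convex_linear_pos, OF order_refl, of P] by simp_all
  then have "convex K"
    unfolding K_def by (intro convex_Int convex_ball)
  have K: "K \<subseteq> - range \<gamma>"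
  proof (intro subsetI ComplI, elim rangeE, hypsubst)
    fix t assume t: "\<gamma> t \<in> K"
    then obtain s where s: "\<bar>s\<bar> < \<delta>" "\<gamma> t = \<alpha> s \<or> \<gamma> t = \<beta> s" using r unfolding K_def by blast
    have cone: "3 * g (\<gamma> t - P) > f (\<gamma> t - P)" "3 * f (\<gamma> t - P) > g (\<gamma> t - P)"
      using t by (simp_all add: K_def)
    from s(2) show False
    proof
      assume "\<gamma> t = \<alpha> s"
      with cone have "3 * g (\<alpha> s - P) > f (\<alpha> s - P)" "3 * f (\<alpha> s - P) > g (\<alpha> s - P)" by simp_all
      then show False using \<alpha>'[OF s(1)] by linarith
    next
      assume "\<gamma> t = \<beta> s"
      with cone have "3 * g (\<beta> s - P) > f (\<beta> s - P)" "3 * f (\<beta> s - P) > g (\<beta> s - P)" by simp_all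
      then show False using \<beta>'[OF s(1)] by linarith
    qed
  qed
  have towards: "\<forall>\<^sub>F e in at_right (0::real). P + e *\<^sub>R (a + b) \<in> K"
  proof -
    define c where "c = r / (norm (a + b) + 1)"
    have "c > 0" using \<open>r > 0\<close> by (simp add: c_def add_nonneg_pos)
    have "P + e *\<^sub>R (a + b) \<in> K" if "e > 0" "e < c" for e
    proof -
      have "e * norm (a + b) \<le> e * (norm (a + b) + 1)" using that by simp
      also have "\<dots> < r" using that(2) by (simp add: c_def pos_less_divide_eq add_nonneg_pos)
      finally have "P + e *\<^sub>R (a + b) \<in> ball P r" using that by (simp add: dist_norm)
      then show ?thesis using that
        by (simp add: K_def f.scaleR g.scaleR f.add g.add base)
    qed
    with \<open>c > 0\<close> show ?thesis unfolding eventually_at_right_field by blast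
  qed
  then obtain e0 where "P + e0 *\<^sub>R (a + b) \<in> K"
    using eventually_happens trivial_limit_at_right_real by blast
  then obtain R where R: "R \<in> regions \<gamma>" "K \<subseteq> R"
    using connected_subset_region[OF convex_connected[OF \<open>convex K\<close>] K] by blast
  have "region_towards \<gamma> P (a + b) R"
    unfolding region_towards_def using R towards by (auto elim: eventually_mono)
  moreover have "\<forall>\<^sub>F h in at_right 0. region_towards \<gamma> (\<alpha> h) b R"
  proof -
    obtain \<rho> where "\<rho> > 0" and \<rho>: "\<And>h e. \<bar>h\<bar> < \<rho> \<Longrightarrow> \<bar>e\<bar> < \<rho> \<Longrightarrow> \<alpha> h + e *\<^sub>R b \<in> ball P r"
      using strictly_differentiable_near[OF \<alpha>(2) \<open>r > 0\<close>, of b] \<alpha>(1) by blast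
    have "region_towards \<gamma> (\<alpha> h) b R" if h: "h > 0" "h < min \<delta> \<rho>" for h
    proof -
      \<comment> \<open>The far end e = h is included: there both coordinates lie between 3h/4 and
        5h/4, so it is in the cone \<open>K\<close> and ties the segment to the region of
        \<open>K\<close>.\<close>
      define J where "J = (\<lambda>e. \<alpha> h + e *\<^sub>R b) ` {0<..h}"
      have coord: "f (\<alpha> h + e *\<^sub>R b - P) = f (\<alpha> h - P)" "g (\<alpha> h + e *\<^sub>R b - P) = g (\<alpha> h - P) + e" for e
        by (simp_all add: f.add f.diff f.scaleR g.add g.diff g.scaleR base)
      have \<alpha>h: "\<bar>f (\<alpha> h - P) - h\<bar> \<le> \<bar>h\<bar> / 4" "\<bar>g (\<alpha> h - P)\<bar> \<le> \<bar>h\<bar> / 4"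
        using \<alpha>'[of h] h by auto
      have "connected J"
        unfolding J_def by (intro connected_continuous_image continuous_intros) auto
      moreover have "J \<subseteq> - range \<gamma>"
      proof (intro subsetI ComplI, elim rangeE, hypsubst)
        fix t assume "\<gamma> t \<in> J"
        then obtain e where e: "0 < e" "e \<le> h" "\<gamma> t = \<alpha> h + e *\<^sub>R b" by (auto simp: J_def)
        then have "\<gamma> t \<in> ball P r" using \<rho>[of h e] h by simp
        then obtain s where s: "\<bar>s\<bar> < \<delta>" "\<gamma> t = \<alpha> s \<or> \<gamma> t = \<beta> s" using r by blast
        from s(2) show False
        proof
          assume as: "\<gamma> t = \<alpha> s"
          then have "\<alpha> s - \<alpha> h = e *\<^sub>R b" using e(3) by (metis add_diff_cancel_left')
          \<comment> \<open>Moving in direction \<open>b\<close> does not change the first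
            coordinate, and strict differentiability makes that coordinate injective along the
            strand.\<close>
          then have "f (\<alpha> s - \<alpha> h) = 0" by (simp add: f.scaleR base)
          then have "\<bar>0 - (s - h)\<bar> \<le> 1/4 * \<bar>s - h\<bar>"
            using d1[of s h] s(1) h by (simp add: base \<delta>_def)
          then have "s - h = 0" by (rule abs_le_quarter)
          then have "e *\<^sub>R b = 0" using as e(3) by simp
          then show False using e(1) base by (auto simp: f.zero g.zero)
        next
          assume "\<gamma> t = \<beta> s"
          then have \<beta>s: "\<beta> s = \<alpha> h + e *\<^sub>R b" using e(3) by simp
          have "f (\<beta> s - P) = f (\<alpha> h - P)" "g (\<beta> s - P) = g (\<alpha> h - P) + e"
            unfolding \<beta>s by (rule coord)+
          then show False using double_cones_disjoint[OF _ _ \<alpha>h e(1,2)] \<beta>'[OF s(1)] by simp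
        qed
      qed
      moreover have end_in: "\<alpha> h + h *\<^sub>R b \<in> J" using h by (auto simp: J_def)
      ultimately obtain R' where R': "R' \<in> regions \<gamma>" "J \<subseteq> R'"
        using connected_subset_region by blast
      have "\<alpha> h + h *\<^sub>R b \<in> ball P r" using \<rho>[of h h] h by simp
      moreover have "3 * g (\<alpha> h + h *\<^sub>R b - P) > f (\<alpha> h + h *\<^sub>R b - P)"
        "3 * f (\<alpha> h + h *\<^sub>R b - P) > g (\<alpha> h + h *\<^sub>R b - P)"
        unfolding coord using abs_le_D1[OF \<alpha>h(1)] abs_le_D1[OF \<alpha>h(2)] abs_le_D2[OF \<alpha>h(1)] abs_le_D2[OF \<alpha>h(2)] h(1)
        by simp_all
      ultimately have "\<alpha> h + h *\<^sub>R b \<in> K" by (simp add: K_def)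
      then have "R' = R" using R R' end_in regions_eq by blast
      moreover have "\<forall>\<^sub>F e in at_right (0::real). \<alpha> h + e *\<^sub>R b \<in> R'"
        unfolding eventually_at_right_field
      proof (intro exI[of _ h] conjI allI impI)
        fix e assume "0 < e" "e < h"
        then have "\<alpha> h + e *\<^sub>R b \<in> J" unfolding J_def by (intro imageI) simp
        then show "\<alpha> h + e *\<^sub>R b \<in> R'" using R'(2) by blast
      qed (rule h(1))
      ultimately show ?thesis using R by (simp add: region_towards_def)
    qed
    moreover have "min \<delta> \<rho> > 0" using \<open>\<delta> > 0\<close> \<open>\<rho> > 0\<close> by simp
    ultimately show ?thesis unfolding eventually_at_right_field by blast
  qed
  ultimately show ?thesis by blast
qed

lemma locally_covered_commute: "locally_covered \<gamma> \<alpha> \<beta> P \<longleftrightarrow> locally_covered \<gamma> \<beta> \<alpha> P"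
  unfolding locally_covered_def by (simp add: disj_commute)

text \<open>Exchanging the strands in the one-sided version yields a second region in the same
  direction a + b; by uniqueness it is the first one.\<close>

lemma crossing_sector:
  assumes \<alpha>: "\<alpha> 0 = P" "strictly_differentiable \<alpha> a"
    and \<beta>: "\<beta> 0 = P" "strictly_differentiable \<beta> b"
    and ab: "cross a b \<noteq> 0" and cover: "locally_covered \<gamma> \<alpha> \<beta> P"
  obtains R where "region_towards \<gamma> P (a + b) R"
    "\<forall>\<^sub>F h in at_right 0. region_towards \<gamma> (\<alpha> h) b R"
    "\<forall>\<^sub>F h in at_right 0. region_towards \<gamma> (\<beta> h) a R"
proof -
  obtain R where R: "region_towards \<gamma> P (a + b) R" "\<forall>\<^sub>F h in at_right 0. region_towards \<gamma> (\<alpha> h) b R"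
    using crossing_sector_half[OF assms] by auto
  have "cross b a \<noteq> 0" using ab by (simp add: cross_swap[of b a])
  then obtain R' where R': "region_towards \<gamma> P (b + a) R'" "\<forall>\<^sub>F h in at_right 0. region_towards \<gamma> (\<beta> h) a R'"
    using crossing_sector_half[OF \<beta> \<alpha> _ cover[THEN iffD1[OF locally_covered_commute]]] by auto
  have "R' = R" using R(1) R'(1) by (metis add.commute region_towards_unique)
  then show thesis using that R R'(2) by blast
qed

text \<open>Pushing a short strand off itself in direction \<open>b\<close> sweeps out a connected
  strip. The strip misses the curve because the coordinate that ignores \<open>b\<close> is
  injective on the strand, so one region serves on both sides of the parameter 0.\<close>

lemma strip_side:
  assumes \<alpha>: "\<alpha> 0 = P" "strictly_differentiable \<alpha> a" "continuous_on UNIV \<alpha>"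
    and ab: "cross a b \<noteq> 0" and cover: "locally_covered \<gamma> \<alpha> \<alpha> P"
  obtains R where "\<forall>\<^sub>F h in nhds 0. region_towards \<gamma> (\<alpha> h) b R"
proof -
  obtain f g where fg: "bounded_linear f" "bounded_linear g"
    and base: "f a = (1::real)" "f b = 0" "g a = (0::real)" "g b = 1"
    using dual_basis[OF ab] .
  interpret f: bounded_linear f by fact
  interpret g: bounded_linear g by fact
  obtain \<delta> where "\<delta> > 0" and \<delta>: "\<And>s t. \<bar>s\<bar> < \<delta> \<Longrightarrow> \<bar>t\<bar> < \<delta> \<Longrightarrow> \<bar>f (\<alpha> s - \<alpha> t) - (s - t) * f a\<bar> \<le> 1/4 * \<bar>s - t\<bar>"
    using strictly_differentiable_linear[OF \<alpha>(2) fg(1), of "1/4"] by auto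
  obtain r where "r > 0" and r: "\<And>t. \<gamma> t \<in> ball P r \<Longrightarrow> \<exists>s. \<bar>s\<bar> < \<delta> \<and> \<gamma> t = \<alpha> s"
    using cover \<open>\<delta> > 0\<close> unfolding locally_covered_def by blast
  obtain \<rho> where "\<rho> > 0" and \<rho>: "\<And>h e. \<bar>h\<bar> < \<rho> \<Longrightarrow> \<bar>e\<bar> < \<rho> \<Longrightarrow> \<alpha> h + e *\<^sub>R b \<in> ball P r"
    using strictly_differentiable_near[OF \<alpha>(2) \<open>r > 0\<close>, of b] \<alpha>(1) by blast
  define c where "c = min \<delta> \<rho>"
  have "c > 0" using \<open>\<delta> > 0\<close> \<open>\<rho> > 0\<close> by (simp add: c_def)
  define N where "N = (\<lambda>x. \<alpha> (fst x) + snd x *\<^sub>R b) ` ({-c<..<c} \<times> {0<..<c})"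
  have "continuous_on ({-c<..<c} \<times> {0<..<c}) (\<lambda>x. \<alpha> (fst x))"
    by (rule continuous_on_compose2[OF \<alpha>(3)]) (auto intro: continuous_intros)
  then have "connected N"
    unfolding N_def
    by (intro connected_continuous_image continuous_intros connected_Times) auto
  moreover have "N \<subseteq> - range \<gamma>"
  proof (intro subsetI ComplI, elim rangeE, hypsubst)
    fix t assume "\<gamma> t \<in> N"
    then obtain h e where e: "\<bar>h\<bar> < c" "0 < e" "e < c" "\<gamma> t = \<alpha> h + e *\<^sub>R b"
      unfolding N_def by force
    then have "\<gamma> t \<in> ball P r" using \<rho>[of h e] by (simp add: c_def)
    then obtain s where s: "\<bar>s\<bar> < \<delta>" "\<gamma> t = \<alpha> s" using r by blast
    then have "\<alpha> s - \<alpha> h = e *\<^sub>R b" using s(2) e(4) by (metis add_diff_cancel_left')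
    then have "f (\<alpha> s - \<alpha> h) = 0" by (simp add: f.scaleR base)
    then have "\<bar>0 - (s - h)\<bar> \<le> 1/4 * \<bar>s - h\<bar>"
      using \<delta>[of s h] s(1) e(1) by (simp add: base c_def)
    then have "s - h = 0" by (rule abs_le_quarter)
    then have "e *\<^sub>R b = 0" using s(2) e(4) by simp
    then show False using e(2) base by (auto simp: f.zero g.zero)
  qed
  moreover have "\<alpha> (fst (0, c / 2)) + snd (0, c / 2) *\<^sub>R b \<in> N"
    unfolding N_def by (rule image_eqI[where x = "(0, c / 2)"]) (use \<open>c > 0\<close> in auto)
  ultimately obtain R where R: "R \<in> regions \<gamma>" "N \<subseteq> R"
    using connected_subset_region by blast
  have "region_towards \<gamma> (\<alpha> h) b R" if "\<bar>h\<bar> < c" for h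
  proof -
    have "\<alpha> h + e *\<^sub>R b \<in> R" if "0 < e" "e < c" for e
    proof -
      have "\<alpha> (fst (h, e)) + snd (h, e) *\<^sub>R b \<in> N"
        unfolding N_def by (rule image_eqI[where x = "(h, e)"]) (use that \<open>\<bar>h\<bar> < c\<close> in auto)
      then show ?thesis using R(2) by auto
    qed
    then show ?thesis
      unfolding region_towards_def eventually_at_right_field using R(1) \<open>c > 0\<close> by blast
  qed
  then have "\<forall>\<^sub>F h in nhds 0. region_towards \<gamma> (\<alpha> h) b R"
    unfolding eventually_nhds_metric using \<open>c > 0\<close> by (auto simp: dist_norm intro!: exI[of _ c])
  then show thesis by (rule that)
qed

text \<open>A truncated convex cone on the left of the tangent is opened wide enough to contain both
  directions, while near \<open>P\<close> the strand stays flatter than the cone.\<close>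

lemma region_towards_same_side:
  assumes \<alpha>: "\<alpha> 0 = P" "strictly_differentiable \<alpha> a"
    and cover: "locally_covered \<gamma> \<alpha> \<alpha> P"
    and d: "cross a d > 0" "cross a d' > 0"
    and R: "region_towards \<gamma> P d R"
  shows "region_towards \<gamma> P d' R"
proof -
  have "cross a d \<noteq> 0" using d by simp
  then obtain f g where fg: "bounded_linear f" "bounded_linear g"
    and base: "f a = (1::real)" "f d = 0" "g a = (0::real)" "g d = 1"
    by (rule dual_basis)
  interpret f: bounded_linear f by fact
  interpret l: bounded_linear "cross a" by (rule bounded_linear_cross)
  obtain M where M: "M > 0" "\<And>q. \<bar>f q\<bar> \<le> norm q * M" using f.pos_bounded by auto
  have nz: "norm d > 0" "norm d' > 0" using d by auto
  define \<eta> where "\<eta> = min (cross a d / norm d) (cross a d' / norm d') / 2"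
  have "\<eta> > 0" using d nz by (simp add: \<eta>_def)
  have half: "min x y / 2 < x \<and> min x y / 2 < y" if "x > 0" "y > 0" for x y :: real
    using that by linarith
  have \<eta>: "\<eta> * norm d < cross a d" "\<eta> * norm d' < cross a d'"
  proof -
    have "cross a d / norm d > 0" "cross a d' / norm d' > 0" using d nz by simp_all
    then have "\<eta> < cross a d / norm d" "\<eta> < cross a d' / norm d'"
      unfolding \<eta>_def using half by blast+
    then show "\<eta> * norm d < cross a d" "\<eta> * norm d' < cross a d'"
      using nz by (simp_all add: field_simps)
  qed
  obtain d1 where "d1 > 0" and d1: "\<And>s t. \<bar>s\<bar> < d1 \<Longrightarrow> \<bar>t\<bar> < d1 \<Longrightarrow> \<bar>f (\<alpha> s - \<alpha> t) - (s - t) * f a\<bar> \<le> 1/2 * \<bar>s - t\<bar>"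
    using strictly_differentiable_linear[OF \<alpha>(2) fg(1), of "1/2"] by auto
  \<comment> \<open>The parameter of a point on the strand is at most 2 M times its distance from
    \<open>P\<close>, so a deviation of \<open>\<eta> / (2 * M)\<close> per unit of parameter is at
    most \<open>\<eta>\<close> per unit of distance.\<close>
  have "\<eta> / (2 * M) > 0" using \<open>\<eta> > 0\<close> M(1) by simp
  then obtain d2 where "d2 > 0" and d2: "\<And>s t. \<bar>s\<bar> < d2 \<Longrightarrow> \<bar>t\<bar> < d2 \<Longrightarrow>
      \<bar>cross a (\<alpha> s - \<alpha> t) - (s - t) * cross a a\<bar> \<le> \<eta> / (2 * M) * \<bar>s - t\<bar>"
    using strictly_differentiable_linear[OF \<alpha>(2) bounded_linear_cross, of "\<eta> / (2 * M)"] by blast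
  have "min d1 d2 > 0" using \<open>d1 > 0\<close> \<open>d2 > 0\<close> by simp
  then obtain r where "r > 0" and r: "\<And>t. \<gamma> t \<in> ball P r \<Longrightarrow> \<exists>s. \<bar>s\<bar> < min d1 d2 \<and> \<gamma> t = \<alpha> s"
    using cover unfolding locally_covered_def by blast
  define K where "K = ball P r \<inter> {z. \<eta> * norm (z - P) < cross a (z - P)}"
  have "convex K"
    unfolding K_def using \<open>\<eta> > 0\<close> by (intro convex_Int convex_ball convex_linear_pos bounded_linear_cross) simp
  moreover have "K \<subseteq> - range \<gamma>"
  proof (intro subsetI ComplI, elim rangeE, hypsubst)
    fix t assume t: "\<gamma> t \<in> K"
    then obtain s where s: "\<bar>s\<bar> < min d1 d2" "\<gamma> t = \<alpha> s" using r unfolding K_def by blast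
    have "\<bar>f (\<alpha> s - P) - s\<bar> \<le> \<bar>s\<bar> / 2"
      using d1[of s 0] s(1) \<open>d1 > 0\<close> \<alpha>(1) by (simp add: base)
    then have "\<bar>s\<bar> \<le> 2 * \<bar>f (\<alpha> s - P)\<bar>" by linarith
    also have "\<dots> \<le> 2 * (norm (\<alpha> s - P) * M)" using M(2)[of "\<alpha> s - P"] by simp
    finally have s_le: "\<bar>s\<bar> \<le> 2 * M * norm (\<alpha> s - P)" by (simp add: ac_simps)
    have "cross a (\<alpha> s - P) \<le> \<eta> / (2 * M) * \<bar>s\<bar>"
      using d2[of s 0] s(1) \<open>d2 > 0\<close> \<alpha>(1) by simp
    also have "\<dots> \<le> \<eta> / (2 * M) * (2 * M * norm (\<alpha> s - P))"
      using s_le \<open>\<eta> / (2 * M) > 0\<close> by (intro mult_left_mono) simp_all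
    also have "\<dots> = \<eta> * norm (\<alpha> s - P)" using M(1) by simp
    finally show False using t s(2) by (simp add: K_def)
  qed
  moreover have into: "\<forall>\<^sub>F e in at_right (0::real). P + e *\<^sub>R x \<in> K"
    if x: "\<eta> * norm x < cross a x" "norm x > 0" for x
  proof -
    have "r / norm x > 0" using \<open>r > 0\<close> x by simp
    moreover have "P + e *\<^sub>R x \<in> K" if "0 < e" "e < r / norm x" for e
    proof -
      have "e * norm x < r" using that x by (simp add: field_simps)
      moreover have "\<eta> * (e * norm x) < e * cross a x" using x that by simp
      ultimately show ?thesis using that by (simp add: K_def dist_norm l.scaleR)
    qed
    ultimately show ?thesis unfolding eventually_at_right_field by blast
  qed
  moreover obtain e where e: "P + e *\<^sub>R d \<in> K" "P + e *\<^sub>R d \<in> R"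
  proof -
    have "\<forall>\<^sub>F e in at_right (0::real). P + e *\<^sub>R d \<in> K \<and> P + e *\<^sub>R d \<in> R"
      using into[OF \<eta>(1) nz(1)] R by (auto simp: region_towards_def intro: eventually_conj)
    then show thesis using that eventually_happens trivial_limit_at_right_real by blast
  qed
  ultimately obtain R' where R': "R' \<in> regions \<gamma>" "K \<subseteq> R'"
    using connected_subset_region convex_connected by metis
  have "R \<in> regions \<gamma>" using R by (simp add: region_towards_def)
  then have "R' = R" using e R' regions_eq[of R' \<gamma> R] by blast
  with R' show ?thesis
    unfolding region_towards_def using into[OF \<eta>(2) nz(2)] by (auto elim: eventually_mono)
qed

section \<open>Arc colours\<close>

lemma immersed_circle_plus_of_nat:
  assumes "immersed_circle \<gamma>"
  shows "\<gamma> (t + real n) = \<gamma> t"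
proof (induction n)
  case (Suc n)
  have "\<gamma> (t + real n + 1) = \<gamma> (t + real n)" using assms unfolding immersed_circle_def by blast
  then show ?case using Suc by (simp add: ac_simps)
qed simp

lemma immersed_circle_plus_of_int:
  assumes "immersed_circle \<gamma>"
  shows "\<gamma> (t + of_int k) = \<gamma> t"
proof (cases "k \<ge> 0")
  case True
  then show ?thesis using immersed_circle_plus_of_nat[OF assms, of t "nat k"] by simp
next
  case False
  then show ?thesis using immersed_circle_plus_of_nat[OF assms, of "t + of_int k" "nat (- k)"] by simp
qed

lemma immersed_circle_has_velocity:
  assumes "immersed_circle \<gamma>"
  shows "(\<gamma> has_vector_derivative velocity \<gamma> t) (at t)"
  using assms unfolding immersed_circle_def C1_differentiable_on_eq velocity_def
  by (simp add: vector_derivative_works)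

lemma immersed_circle_continuous:
  assumes "immersed_circle \<gamma>"
  shows "continuous_on S \<gamma>"
  using immersed_circle_has_velocity[OF assms] has_vector_derivative_continuous
  by (blast intro: continuous_at_imp_continuous_on)

lemma immersed_circle_velocity_continuous:
  assumes "immersed_circle \<gamma>"
  shows "isCont (velocity \<gamma>) t"
proof -
  have "continuous_on UNIV (\<lambda>t. vector_derivative \<gamma> (at t))"
    using assms unfolding immersed_circle_def C1_differentiable_on_eq by blast
  then have "continuous_on UNIV (velocity \<gamma>)" by (simp add: velocity_def[abs_def])
  then show ?thesis by (simp add: continuous_on_eq_continuous_at)
qed

lemma velocity_plus_of_int:
  assumes "immersed_circle \<gamma>"
  shows "velocity \<gamma> (t + of_int k) = velocity \<gamma> t"
proof -
  have "((\<lambda>x. x + of_int k) has_vector_derivative 1) (at t)"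
    by (auto intro!: derivative_eq_intros simp flip: has_real_derivative_iff_has_vector_derivative)
  from vector_diff_chain_at[OF this immersed_circle_has_velocity[OF assms]]
  have "((\<lambda>x. \<gamma> (x + of_int k)) has_vector_derivative velocity \<gamma> (t + of_int k)) (at t)"
    by (simp add: o_def)
  then have "(\<gamma> has_vector_derivative velocity \<gamma> (t + of_int k)) (at t)"
    by (simp add: immersed_circle_plus_of_int[OF assms])
  then show ?thesis
    using immersed_circle_has_velocity[OF assms] vector_derivative_unique_at by blast
qed

text \<open>Mean value inequality: near \<open>t\<close> the velocity stays within
  \<open>\<epsilon>\<close> of its value at \<open>t\<close>, which bounds the error between any two
  nearby parameters.\<close>

lemma immersed_circle_strictly_differentiable:
  assumes "immersed_circle \<gamma>"
  shows "strictly_differentiable (\<lambda>h. \<gamma> (t + h)) (velocity \<gamma> t)"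
  unfolding strictly_differentiable_def
proof (intro allI impI)
  fix \<epsilon> :: real assume "\<epsilon> > 0"
  then obtain \<delta> where "\<delta> > 0" and \<delta>: "\<And>x. dist x t < \<delta> \<Longrightarrow> dist (velocity \<gamma> x) (velocity \<gamma> t) < \<epsilon>"
    using immersed_circle_velocity_continuous[OF assms, of t] unfolding continuous_at_eps_delta by blast
  have "norm (\<gamma> (t + r) - \<gamma> (t + s) - (r - s) *\<^sub>R velocity \<gamma> t) \<le> \<epsilon> * \<bar>r - s\<bar>"
    if "\<bar>r\<bar> < \<delta>" "\<bar>s\<bar> < \<delta>" for r s
  proof -
    have "norm (\<gamma> (t + r) - \<gamma> (t + s) - (t + r - (t + s)) *\<^sub>R velocity \<gamma> t) \<le> norm (t + r - (t + s)) * \<epsilon>"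
    proof (rule vector_differentiable_bound_linearization[where S = "ball t \<delta>" and f' = "velocity \<gamma>"])
      show "(\<gamma> has_vector_derivative velocity \<gamma> x) (at x within ball t \<delta>)" for x
        by (rule has_vector_derivative_at_within[OF immersed_circle_has_velocity[OF assms]])
      show "closed_segment (t + s) (t + r) \<subseteq> ball t \<delta>"
        by (rule closed_segment_subset) (use that in \<open>auto simp: dist_norm\<close>)
      show "norm (velocity \<gamma> x - velocity \<gamma> t) \<le> \<epsilon>" if "x \<in> ball t \<delta>" for x
        using \<delta>[of x] that unfolding mem_ball dist_commute[of t] by (simp add: dist_norm)
    qed (use \<open>\<delta> > 0\<close> in simp)
    then show ?thesis by (simp add: mult.commute)
  qed
  with \<open>\<delta> > 0\<close> show "\<exists>\<delta>>0. \<forall>r s. \<bar>r\<bar> < \<delta> \<and> \<bar>s\<bar> < \<delta> \<longrightarrow>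
      norm (\<gamma> (t + r) - \<gamma> (t + s) - (r - s) *\<^sub>R velocity \<gamma> t) \<le> \<epsilon> * \<bar>r - s\<bar>"
    by blast
qed

text \<open>Compactness: the parameters in [0, 1] that keep distance \<open>\<delta>\<close> from
  all translates of \<open>s\<close> and \<open>t\<close> have a closed image that misses
  \<open>P\<close>, hence misses a ball around it.\<close>

lemma immersed_circle_locally_covered:
  assumes "immersed_circle \<gamma>"
    and fibre: "\<And>x. \<gamma> x = P \<Longrightarrow> \<exists>k::int. x = s + of_int k \<or> x = t + of_int k"
  shows "locally_covered \<gamma> (\<lambda>h. \<gamma> (s + h)) (\<lambda>h. \<gamma> (t + h)) P"
  unfolding locally_covered_def
proof (intro allI impI)
  fix \<delta> :: real assume "\<delta> > 0"
  define U where "U = (\<Union>k::int. ball (s + of_int k) \<delta> \<union> ball (t + of_int k) \<delta>)"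
  have "open U" unfolding U_def by auto
  then have "compact ({0..1} - U)" by (intro compact_diff) simp_all
  then have "compact (\<gamma> ` ({0..1} - U))"
    by (intro compact_continuous_image immersed_circle_continuous[OF assms(1)])
  then have "open (- \<gamma> ` ({0..1} - U))" by (simp add: compact_imp_closed open_Compl)
  moreover have "P \<in> - \<gamma> ` ({0..1} - U)"
  proof (intro ComplI, elim imageE)
    fix x assume "P = \<gamma> x" "x \<in> {0..1} - U"
    then obtain k :: int where "x = s + of_int k \<or> x = t + of_int k" using fibre by metis
    then have "x \<in> ball (s + of_int k) \<delta> \<union> ball (t + of_int k) \<delta>" using \<open>\<delta> > 0\<close> by auto
    then have "x \<in> U" unfolding U_def by blast
    with \<open>x \<in> {0..1} - U\<close> show False by simp
  qed
  ultimately obtain r where "r > 0" and r: "ball P r \<subseteq> - \<gamma> ` ({0..1} - U)"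
    by (meson open_contains_ball)
  have "\<exists>h. \<bar>h\<bar> < \<delta> \<and> (\<gamma> x = \<gamma> (s + h) \<or> \<gamma> x = \<gamma> (t + h))" if "\<gamma> x \<in> ball P r" for x
  proof -
    have eq: "\<gamma> (frac x) = \<gamma> x"
      using immersed_circle_plus_of_int[OF assms(1), of x "- \<lfloor>x\<rfloor>"] by (simp add: frac_def)
    have "frac x \<in> {0..1}" using frac_ge_0[of x] frac_lt_1[of x] by simp
    with r that eq have "frac x \<in> U" by (metis ComplD DiffI image_eqI subsetD)
    then obtain k :: int where k: "dist (s + of_int k) (frac x) < \<delta> \<or> dist (t + of_int k) (frac x) < \<delta>"
      by (auto simp: U_def)
    have shift: "\<gamma> (u + (frac x - of_int k - u)) = \<gamma> x" for u
      using immersed_circle_plus_of_int[OF assms(1), of "frac x" "- k"] eq by simp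
    from k show ?thesis
    proof
      assume "dist (s + of_int k) (frac x) < \<delta>"
      then show ?thesis
        using shift[of s] by (intro exI[of _ "frac x - of_int k - s"]) (auto simp: dist_real_def)
    next
      assume "dist (t + of_int k) (frac x) < \<delta>"
      then show ?thesis
        using shift[of t] by (intro exI[of _ "frac x - of_int k - t"]) (auto simp: dist_real_def)
    qed
  qed
  with \<open>r > 0\<close> show "\<exists>r>0. \<forall>x. \<gamma> x \<in> ball P r \<longrightarrow>
      (\<exists>h. \<bar>h\<bar> < \<delta> \<and> (\<gamma> x = \<gamma> (s + h) \<or> \<gamma> x = \<gamma> (t + h)))"
    by blast
qed

definition simple_at :: "(real \<Rightarrow> complex) \<Rightarrow> real \<Rightarrow> bool" where
  "simple_at \<gamma> t \<longleftrightarrow> (\<forall>s. \<gamma> s = \<gamma> t \<longrightarrow> (\<exists>k::int. s = t + of_int k))"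

text \<open>Meaningful only at simple points: at a crossing there may be no such region.\<close>

definition side_region :: "(real \<Rightarrow> complex) \<Rightarrow> complex \<Rightarrow> real \<Rightarrow> complex set" where
  "side_region \<gamma> w t = (THE R. region_towards \<gamma> (\<gamma> t) (w * velocity \<gamma> t) R)"

definition arc_colour :: "(real \<Rightarrow> complex) \<Rightarrow> (complex set \<Rightarrow> int) \<Rightarrow> real \<Rightarrow> int" where
  "arc_colour \<gamma> C t = C (side_region \<gamma> \<i> t) + C (side_region \<gamma> (- \<i>) t)"

lemma arc_colour_plus_of_int:
  assumes "immersed_circle \<gamma>"
  shows "arc_colour \<gamma> C (t + of_int k) = arc_colour \<gamma> C t"
  unfolding arc_colour_def side_region_def
  by (simp add: immersed_circle_plus_of_int[OF assms] velocity_plus_of_int[OF assms])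

lemma simple_at_locally_covered:
  assumes "immersed_circle \<gamma>" "simple_at \<gamma> t"
  shows "locally_covered \<gamma> (\<lambda>h. \<gamma> (t + h)) (\<lambda>h. \<gamma> (t + h)) (\<gamma> t)"
  using assms by (intro immersed_circle_locally_covered) (auto simp: simple_at_def)

lemma cross_times_ii: "cross a (\<i> * a) = (norm a)\<^sup>2" "cross a (- \<i> * a) = - (norm a)\<^sup>2"
  unfolding cross_def cmod_power2 by (simp_all add: power2_eq_square)

text \<open>A positive product says that both directions are on the same side without saying which;
  the right side is reduced to the left one by reversing the strand.\<close>

lemma side_region_eq:
  assumes im: "immersed_circle \<gamma>" "simple_at \<gamma> t"
    and d: "cross (velocity \<gamma> t) d * cross (velocity \<gamma> t) (w * velocity \<gamma> t) > 0"
    and R: "region_towards \<gamma> (\<gamma> t) d R"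
  shows "side_region \<gamma> w t = R"
proof -
  let ?a = "velocity \<gamma> t" and ?d' = "w * velocity \<gamma> t"
  have sd: "strictly_differentiable (\<lambda>h. \<gamma> (t + h)) ?a"
    by (rule immersed_circle_strictly_differentiable[OF im(1)])
  have cov: "locally_covered \<gamma> (\<lambda>h. \<gamma> (t + h)) (\<lambda>h. \<gamma> (t + h)) (\<gamma> t)"
    by (rule simple_at_locally_covered[OF im])
  have sd': "strictly_differentiable (\<lambda>h. \<gamma> (t - h)) (- ?a)"
    using strictly_differentiable_reverse[OF sd] by simp
  have cov': "locally_covered \<gamma> (\<lambda>h. \<gamma> (t - h)) (\<lambda>h. \<gamma> (t - h)) (\<gamma> t)"
    using cov unfolding locally_covered_def
    by (metis abs_minus_cancel add_uminus_conv_diff minus_minus diff_minus_eq_add)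
  have "region_towards \<gamma> (\<gamma> t) ?d' R"
  proof (cases "cross ?a d > 0")
    case True
    then have "cross ?a ?d' > 0" using d by (simp add: zero_less_mult_iff)
    then show ?thesis using region_towards_same_side[OF _ sd cov True _ R] by simp
  next
    case False
    then have neg: "cross (- ?a) d > 0" "cross (- ?a) ?d' > 0" using d by (auto simp: zero_less_mult_iff)
    then show ?thesis using region_towards_same_side[OF _ sd' cov' neg R] by simp
  qed
  then show ?thesis
    unfolding side_region_def using region_towards_unique by (intro the_equality) blast+
qed

text \<open>The sum is symmetric in the two sides, so any transversal direction can replace the
  normal, whichever way it points. Near a crossing this direction will be the velocity of the other
  strand.\<close>

lemma arc_colour_eq:
  assumes im: "immersed_circle \<gamma>" "simple_at \<gamma> t"
    and d: "cross (velocity \<gamma> t) d \<noteq> 0"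
    and R: "region_towards \<gamma> (\<gamma> t) d R" "region_towards \<gamma> (\<gamma> t) (- d) R'"
  shows "arc_colour \<gamma> C t = C R + C R'"
proof -
  have "velocity \<gamma> t \<noteq> 0" using im(1) by (simp add: immersed_circle_def)
  then have n: "(norm (velocity \<gamma> t))\<^sup>2 > 0" by simp
  show ?thesis
  proof (cases "cross (velocity \<gamma> t) d > 0")
    case True
    then have "side_region \<gamma> \<i> t = R" "side_region \<gamma> (- \<i>) t = R'"
      using n by (auto intro!: side_region_eq[OF im _ R(1)] side_region_eq[OF im _ R(2)]
        simp: cross_times_ii mult_neg_neg simp del: mult_minus_left)
    then show ?thesis by (simp add: arc_colour_def)
  next
    case False
    then have "cross (velocity \<gamma> t) d < 0" using d by simp
    then have "side_region \<gamma> \<i> t = R'" "side_region \<gamma> (- \<i>) t = R"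
      using n by (auto intro!: side_region_eq[OF im _ R(1)] side_region_eq[OF im _ R(2)]
        simp: cross_times_ii mult_neg_pos simp del: mult_minus_left)
    then show ?thesis by (simp add: arc_colour_def)
  qed
qed

lemma eventually_nhds_shift:
  "eventually P (nhds (0::real)) \<Longrightarrow> \<forall>\<^sub>F x in nhds t. P (x - t)"
  using filtermap_nhds_shift[of t t] by (metis diff_self eventually_filtermap)

lemma velocity_transversal:
  assumes "immersed_circle \<gamma>" "cross (velocity \<gamma> t) d \<noteq> 0"
  shows "\<forall>\<^sub>F x in nhds t. cross (velocity \<gamma> x) d \<noteq> 0"
proof -
  have "isCont (\<lambda>x. cross (velocity \<gamma> x) d) t"
    unfolding cross_def by (intro isCont_Im continuous_mult isCont_cnj continuous_const immersed_circle_velocity_continuous assms)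
  then have "((\<lambda>x. cross (velocity \<gamma> x) d) \<longlongrightarrow> cross (velocity \<gamma> t) d) (nhds t)"
    by (simp add: tendsto_nhds_iff continuous_at)
  then show ?thesis by (rule tendsto_imp_eventually_ne) (rule assms)
qed

text \<open>The normal turns with the point. The fixed normal at \<open>t\<close> stays transversal
  nearby and sees the same two regions along the strip.\<close>

lemma arc_colour_locally_const:
  assumes im: "immersed_circle \<gamma>" "simple_at \<gamma> t"
  obtains R R' where "R \<in> regions \<gamma>" "R' \<in> regions \<gamma>"
    "\<forall>\<^sub>F x in nhds t. simple_at \<gamma> x \<longrightarrow> arc_colour \<gamma> C x = C R + C R'"
proof -
  let ?d = "\<i> * velocity \<gamma> t"
  have d: "cross (velocity \<gamma> t) ?d \<noteq> 0" "cross (velocity \<gamma> t) (- ?d) \<noteq> 0"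
    using im(1) by (simp_all add: cross_times_ii immersed_circle_def)
  have sd: "strictly_differentiable (\<lambda>h. \<gamma> (t + h)) (velocity \<gamma> t)"
    by (rule immersed_circle_strictly_differentiable[OF im(1)])
  have cov: "locally_covered \<gamma> (\<lambda>h. \<gamma> (t + h)) (\<lambda>h. \<gamma> (t + h)) (\<gamma> t)"
    by (rule simple_at_locally_covered[OF im])
  have cont: "continuous_on UNIV (\<lambda>h. \<gamma> (t + h))"
    by (rule continuous_on_compose2[OF immersed_circle_continuous[OF im(1), of UNIV]])
      (auto intro: continuous_intros)
  obtain R where R: "\<forall>\<^sub>F h in nhds 0. region_towards \<gamma> (\<gamma> (t + h)) ?d R"
    using strip_side[OF _ sd cont d(1) cov] by auto
  obtain R' where R': "\<forall>\<^sub>F h in nhds 0. region_towards \<gamma> (\<gamma> (t + h)) (- ?d) R'"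
    using strip_side[OF _ sd cont d(2) cov] by auto
  show thesis
  proof
    show "R \<in> regions \<gamma>" "R' \<in> regions \<gamma>"
      using eventually_nhds_x_imp_x[OF R] eventually_nhds_x_imp_x[OF R'] by (auto simp: region_towards_def)
    show "\<forall>\<^sub>F x in nhds t. simple_at \<gamma> x \<longrightarrow> arc_colour \<gamma> C x = C R + C R'"
      using eventually_nhds_shift[OF R, of t] eventually_nhds_shift[OF R', of t]
        velocity_transversal[OF im(1) d(1)]
    proof eventually_elim
      case (elim x)
      then show ?case using arc_colour_eq[OF im(1) _ elim(3)] by simp
    qed
  qed
qed

lemma locally_covered_reverse:
  assumes "locally_covered \<gamma> \<alpha> \<beta> P"
  shows "locally_covered \<gamma> (\<lambda>h. \<alpha> (- h)) \<beta> P"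
  unfolding locally_covered_def
proof (intro allI impI)
  fix \<delta> :: real assume "\<delta> > 0"
  then obtain r where "r > 0" and r: "\<And>t. \<gamma> t \<in> ball P r \<Longrightarrow> \<exists>s. \<bar>s\<bar> < \<delta> \<and> (\<gamma> t = \<alpha> s \<or> \<gamma> t = \<beta> s)"
    using assms unfolding locally_covered_def by blast
  have "\<exists>s. \<bar>s\<bar> < \<delta> \<and> (\<gamma> t = \<alpha> (- s) \<or> \<gamma> t = \<beta> s)" if t: "\<gamma> t \<in> ball P r" for t
  proof -
    obtain s where s: "\<bar>s\<bar> < \<delta>" "\<gamma> t = \<alpha> s \<or> \<gamma> t = \<beta> s" using r[OF t] by blast
    from s(2) show ?thesis
    proof
      assume "\<gamma> t = \<alpha> s"
      then show ?thesis using s(1) by (intro exI[of _ "- s"]) simp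
    next
      assume "\<gamma> t = \<beta> s"
      then show ?thesis using s(1) by (intro exI[of _ s]) simp
    qed
  qed
  with \<open>r > 0\<close> show "\<exists>r>0. \<forall>t. \<gamma> t \<in> ball P r \<longrightarrow>
      (\<exists>s. \<bar>s\<bar> < \<delta> \<and> (\<gamma> t = \<alpha> (- s) \<or> \<gamma> t = \<beta> s))" by blast
qed

section \<open>Double points and colours around a crossing\<close>

lemma immersed_circle_frac:
  assumes "immersed_circle \<gamma>"
  shows "\<gamma> (frac x) = \<gamma> x"
  using immersed_circle_plus_of_int[OF assms, of x "- \<lfloor>x\<rfloor>"] by (simp add: frac_def)

lemma not_simple_at_imp_double_point:
  assumes "immersed_circle \<gamma>" "\<not> simple_at \<gamma> x"
  obtains t where "(frac x, t) \<in> double_points \<gamma>"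
proof -
  obtain y where y: "\<gamma> y = \<gamma> x" and ne: "\<And>k::int. y \<noteq> x + of_int k"
    using assms(2) unfolding simple_at_def by blast
  have "frac x \<noteq> frac y"
  proof
    assume "frac x = frac y"
    then have "y = x + of_int (\<lfloor>y\<rfloor> - \<lfloor>x\<rfloor>)" by (simp add: frac_def)
    then show False using ne by blast
  qed
  then have "(frac x, frac y) \<in> double_points \<gamma>"
    using y immersed_circle_frac[OF assms(1), of x] immersed_circle_frac[OF assms(1), of y]
      frac_ge_0[of x] frac_ge_0[of y] frac_lt_1[of x] frac_lt_1[of y] by (simp add: double_points_def)
  then show thesis by (rule that)
qed

text \<open>Genericity excludes triple points: a third parameter would be a second partner of
  \<open>s\<close>.\<close>

lemma double_point_fibre:
  assumes gen: "generic_immersed_circle \<gamma>" and st: "(s, t) \<in> double_points \<gamma>" and x: "\<gamma> x = \<gamma> s"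
  shows "\<exists>k::int. x = s + of_int k \<or> x = t + of_int k"
proof -
  have im: "immersed_circle \<gamma>" using gen by (simp add: generic_immersed_circle_def)
  have "frac x = s \<or> frac x = t"
  proof (rule disjCI)
    assume "frac x \<noteq> t"
    have "(s, frac x) \<in> double_points \<gamma>" if "frac x \<noteq> s"
      using st x that immersed_circle_frac[OF im, of x] frac_ge_0[of x] frac_lt_1[of x]
      by (simp add: double_points_def)
    then show "frac x = s"
      using gen st \<open>frac x \<noteq> t\<close> unfolding generic_immersed_circle_def by blast
  qed
  then have "x = s + of_int \<lfloor>x\<rfloor> \<or> x = t + of_int \<lfloor>x\<rfloor>" by (auto simp: frac_def)
  then show ?thesis by blast
qed

text \<open>Non-simple parameters are integer translates of finitely many, so a bounded interval
  contains finitely many and they do not accumulate.\<close>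

lemma eventually_simple_at:
  assumes gen: "generic_immersed_circle \<gamma>"
  shows "\<forall>\<^sub>F x in at t. simple_at \<gamma> x"
proof -
  have im: "immersed_circle \<gamma>" and fin: "finite (double_points \<gamma>)"
    using gen by (simp_all add: generic_immersed_circle_def)
  define A where "A = {x \<in> ball t 1. \<not> simple_at \<gamma> x}"
  have "A \<subseteq> (\<lambda>(f, k). f + of_int k) ` (fst ` double_points \<gamma> \<times> {\<lfloor>t\<rfloor> - 2..\<lfloor>t\<rfloor> + 2})"
  proof
    fix x assume x: "x \<in> A"
    then obtain y where y: "(frac x, y) \<in> double_points \<gamma>"
      using not_simple_at_imp_double_point[OF im] unfolding A_def by blast
    have "t - 1 < x" "x < t + 1" using x by (simp_all add: A_def dist_real_def abs_less_iff)
    then have "\<lfloor>x\<rfloor> \<in> {\<lfloor>t\<rfloor> - 2..\<lfloor>t\<rfloor> + 2}" by simp linarith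
    moreover have "frac x \<in> fst ` double_points \<gamma>" using y by force
    ultimately show "x \<in> (\<lambda>(f, k). f + of_int k) ` (fst ` double_points \<gamma> \<times> {\<lfloor>t\<rfloor> - 2..\<lfloor>t\<rfloor> + 2})"
      by (intro image_eqI[where x = "(frac x, \<lfloor>x\<rfloor>)"]) (auto simp: frac_def)
  qed
  then have "finite A" by (rule finite_subset) (use fin in simp)
  then have "\<forall>\<^sub>F x in at t. x \<notin> A"
    using islimpt_finite islimpt_iff_eventually by blast
  moreover have "\<forall>\<^sub>F x in at t. x \<in> ball t 1"
    by (rule eventually_at_in_open') simp_all
  ultimately show ?thesis by eventually_elim (auto simp: A_def)
qed

text \<open>Reversing neither, one or both strands produces the four sectors. Each of the four
  half-strands borders two of them, and its colour is read off with the velocity of the other strand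
  as transversal direction. Over and under play no part yet.\<close>

lemma crossing_colours:
  assumes gen: "generic_immersed_circle \<gamma>" and st: "(s, t) \<in> double_points \<gamma>"
  obtains x1 x2 x3 x4 where
    "region_towards \<gamma> (\<gamma> s) (velocity \<gamma> s + velocity \<gamma> t) x1"
    "region_towards \<gamma> (\<gamma> s) (- velocity \<gamma> s + velocity \<gamma> t) x2"
    "region_towards \<gamma> (\<gamma> s) (velocity \<gamma> s - velocity \<gamma> t) x3"
    "region_towards \<gamma> (\<gamma> s) (- velocity \<gamma> s - velocity \<gamma> t) x4"
    "\<forall>\<^sub>F h in at_right 0. simple_at \<gamma> (s + h) \<longrightarrow> arc_colour \<gamma> C (s + h) = C x1 + C x3"
    "\<forall>\<^sub>F h in at_right 0. simple_at \<gamma> (s - h) \<longrightarrow> arc_colour \<gamma> C (s - h) = C x2 + C x4"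
    "\<forall>\<^sub>F h in at_right 0. simple_at \<gamma> (t + h) \<longrightarrow> arc_colour \<gamma> C (t + h) = C x1 + C x2"
    "\<forall>\<^sub>F h in at_right 0. simple_at \<gamma> (t - h) \<longrightarrow> arc_colour \<gamma> C (t - h) = C x3 + C x4"
proof -
  let ?u = "velocity \<gamma> s" and ?v = "velocity \<gamma> t"
  have im: "immersed_circle \<gamma>" using gen by (simp add: generic_immersed_circle_def)
  have P: "\<gamma> t = \<gamma> s" using st by (simp add: double_points_def)
  have vu: "cross ?v ?u \<noteq> 0"
    using gen st cross_eq_0_imp_span[of ?v ?u] im
    unfolding generic_immersed_circle_def immersed_circle_def by blast
  then have uv: "cross ?u ?v \<noteq> 0" by (simp add: cross_swap[of ?u ?v])
  note sd = immersed_circle_strictly_differentiable[OF im]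
  note sd' = strictly_differentiable_reverse[OF immersed_circle_strictly_differentiable[OF im]]
  have cov: "locally_covered \<gamma> (\<lambda>h. \<gamma> (s + h)) (\<lambda>h. \<gamma> (t + h)) (\<gamma> s)"
    using double_point_fibre[OF gen st] by (intro immersed_circle_locally_covered[OF im])
  note cov2 = locally_covered_reverse[OF cov]
  have cov3: "locally_covered \<gamma> (\<lambda>h. \<gamma> (s + h)) (\<lambda>h. \<gamma> (t + - h)) (\<gamma> s)"
    using locally_covered_reverse[OF cov[THEN iffD1[OF locally_covered_commute]]]
    by (rule iffD1[OF locally_covered_commute])
  note cov4 = locally_covered_reverse[OF cov3]
  obtain x1 where x1: "region_towards \<gamma> (\<gamma> s) (?u + ?v) x1"
    "\<forall>\<^sub>F h in at_right 0. region_towards \<gamma> (\<gamma> (s + h)) ?v x1"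
    "\<forall>\<^sub>F h in at_right 0. region_towards \<gamma> (\<gamma> (t + h)) ?u x1"
    by (rule crossing_sector[OF _ sd _ sd uv cov]) (simp_all add: P)
  obtain x2 where x2: "region_towards \<gamma> (\<gamma> s) (- ?u + ?v) x2"
    "\<forall>\<^sub>F h in at_right 0. region_towards \<gamma> (\<gamma> (s + - h)) ?v x2"
    "\<forall>\<^sub>F h in at_right 0. region_towards \<gamma> (\<gamma> (t + h)) (- ?u) x2"
    by (rule crossing_sector[OF _ sd' _ sd _ cov2]) (use uv in \<open>simp_all add: P\<close>)
  obtain x3 where x3: "region_towards \<gamma> (\<gamma> s) (?u + - ?v) x3"
    "\<forall>\<^sub>F h in at_right 0. region_towards \<gamma> (\<gamma> (s + h)) (- ?v) x3"
    "\<forall>\<^sub>F h in at_right 0. region_towards \<gamma> (\<gamma> (t + - h)) ?u x3"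
    by (rule crossing_sector[OF _ sd _ sd' _ cov3]) (use uv in \<open>simp_all add: P\<close>)
  obtain x4 where x4: "region_towards \<gamma> (\<gamma> s) (- ?u + - ?v) x4"
    "\<forall>\<^sub>F h in at_right 0. region_towards \<gamma> (\<gamma> (s + - h)) (- ?v) x4"
    "\<forall>\<^sub>F h in at_right 0. region_towards \<gamma> (\<gamma> (t + - h)) (- ?u) x4"
    by (rule crossing_sector[OF _ sd' _ sd' _ cov4]) (use uv in \<open>simp_all add: P\<close>)
  have shift: "\<forall>\<^sub>F h in at_right 0. Q (r + c * h)" if "\<forall>\<^sub>F x in nhds r. Q x" for Q and r c :: real
  proof -
    have "((\<lambda>h. r + c * h) \<longlongrightarrow> r + c * 0) (at_right 0)" by (intro tendsto_intros)
    then show ?thesis using that by (auto simp: filterlim_iff)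
  qed
  have tr: "\<forall>\<^sub>F h in at_right 0. cross (velocity \<gamma> (s + h)) ?v \<noteq> 0"
    "\<forall>\<^sub>F h in at_right 0. cross (velocity \<gamma> (s + - h)) ?v \<noteq> 0"
    "\<forall>\<^sub>F h in at_right 0. cross (velocity \<gamma> (t + h)) ?u \<noteq> 0"
    "\<forall>\<^sub>F h in at_right 0. cross (velocity \<gamma> (t + - h)) ?u \<noteq> 0"
    using shift[OF velocity_transversal[OF im uv], of 1] shift[OF velocity_transversal[OF im uv], of "-1"]
      shift[OF velocity_transversal[OF im vu], of 1] shift[OF velocity_transversal[OF im vu], of "-1"]
    by simp_all
  have colour: "\<forall>\<^sub>F h in at_right 0. simple_at \<gamma> (f h) \<longrightarrow> arc_colour \<gamma> C (f h) = C R + C R'"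
    if "\<forall>\<^sub>F h in at_right 0. cross (velocity \<gamma> (f h)) d \<noteq> 0"
      "\<forall>\<^sub>F h in at_right 0. region_towards \<gamma> (\<gamma> (f h)) d R"
      "\<forall>\<^sub>F h in at_right 0. region_towards \<gamma> (\<gamma> (f h)) (- d) R'" for f :: "real \<Rightarrow> real" and d R R'
    using that
  proof eventually_elim
    case (elim h)
    then show ?case using arc_colour_eq[OF im _ elim] by blast
  qed
  show thesis
    using that[OF x1(1) x2(1) x3(1)[folded diff_conv_add_uminus] x4(1)[folded diff_conv_add_uminus]
      colour[OF tr(1) x1(2) x3(2)] colour[OF tr(2) x2(2) x4(2), folded diff_conv_add_uminus]
      colour[OF tr(3) x1(3) x2(3)] colour[OF tr(4) x3(3) x4(3), folded diff_conv_add_uminus]] .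
qed

text \<open>The sign choices act as a Klein four-group on the sectors and preserve the partition
  into opposite pairs, so nontriviality can be tested in a single naming.\<close>

lemma surrounding_regions_cases:
  assumes y: "surrounding_regions \<gamma> c y1 y2 y3 y4"
    and x: "region_towards \<gamma> (\<gamma> (fst c)) (velocity \<gamma> (fst c) + velocity \<gamma> (snd c)) x1"
    "region_towards \<gamma> (\<gamma> (fst c)) (- velocity \<gamma> (fst c) + velocity \<gamma> (snd c)) x2"
    "region_towards \<gamma> (\<gamma> (fst c)) (velocity \<gamma> (fst c) - velocity \<gamma> (snd c)) x3"
    "region_towards \<gamma> (\<gamma> (fst c)) (- velocity \<gamma> (fst c) - velocity \<gamma> (snd c)) x4"
  shows "(y1, y4) \<in> {(x1, x4), (x4, x1)} \<and> (y2, y3) \<in> {(x2, x3), (x3, x2)} \<or>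
    (y1, y4) \<in> {(x2, x3), (x3, x2)} \<and> (y2, y3) \<in> {(x1, x4), (x4, x1)}"
proof -
  have unique: "y = x" if "region_towards \<gamma> (\<gamma> (fst c)) w y" "region_towards \<gamma> (\<gamma> (fst c)) w' x" "w = w'"
    for w w' y x using that region_towards_unique by blast
  from y obtain u v where
    u: "u \<in> {velocity \<gamma> (fst c), - velocity \<gamma> (fst c)}" and
    v: "v \<in> {velocity \<gamma> (snd c), - velocity \<gamma> (snd c)}" and
    y: "region_towards \<gamma> (\<gamma> (fst c)) (u + v) y1" "region_towards \<gamma> (\<gamma> (fst c)) (- u + v) y2"
      "region_towards \<gamma> (\<gamma> (fst c)) (u - v) y3" "region_towards \<gamma> (\<gamma> (fst c)) (- u - v) y4"
    unfolding surrounding_regions_def by blast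
  from u v consider "u = velocity \<gamma> (fst c)" "v = velocity \<gamma> (snd c)"
    | "u = - velocity \<gamma> (fst c)" "v = velocity \<gamma> (snd c)"
    | "u = velocity \<gamma> (fst c)" "v = - velocity \<gamma> (snd c)"
    | "u = - velocity \<gamma> (fst c)" "v = - velocity \<gamma> (snd c)" by blast
  then show ?thesis
  proof cases
    case 1
    then have "y1 = x1" "y2 = x2" "y3 = x3" "y4 = x4"
      using unique[OF y(1) x(1)]
        unique[OF y(2) x(2)]
        unique[OF y(3) x(3)]
        unique[OF y(4) x(4)] by simp_all
    then show ?thesis by simp
  next
    case 2
    then have "y1 = x2" "y2 = x1" "y3 = x4" "y4 = x3"
      using unique[OF y(1) x(2)]
        unique[OF y(2) x(1)]
        unique[OF y(3) x(4)]
        unique[OF y(4) x(3)] by simp_all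
    then show ?thesis by simp
  next
    case 3
    then have "y1 = x3" "y2 = x4" "y3 = x1" "y4 = x2"
      using unique[OF y(1) x(3)]
        unique[OF y(2) x(4)]
        unique[OF y(3) x(1)]
        unique[OF y(4) x(2)] by simp_all
    then show ?thesis by simp
  next
    case 4
    then have "y1 = x4" "y2 = x3" "y3 = x2" "y4 = x1"
      using unique[OF y(1) x(4)]
        unique[OF y(2) x(3)]
        unique[OF y(3) x(2)]
        unique[OF y(4) x(1)] by simp_all
    then show ?thesis by simp
  qed
qed

section \<open>The graph of arc colours modulo p\<close>

definition arc_residues :: "nat \<Rightarrow> (real \<Rightarrow> complex) \<Rightarrow> (complex set \<Rightarrow> int) \<Rightarrow> int set" where
  "arc_residues p \<gamma> C = (\<lambda>t. arc_colour \<gamma> C t mod int p) ` {t. simple_at \<gamma> t}"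

text \<open>Phrased without crossings: it keeps only the algebra that a crossing provides, so
  residues may also be linked without being the under-arcs of a common crossing.\<close>

definition arc_links :: "nat \<Rightarrow> (real \<Rightarrow> complex) \<Rightarrow> (complex set \<Rightarrow> int) \<Rightarrow> (int \<times> int) set" where
  "arc_links p \<gamma> C = {(b, c). b \<in> arc_residues p \<gamma> C \<and> c \<in> arc_residues p \<gamma> C \<and> b \<noteq> c \<and>
     (\<exists>a1\<in>color_set \<gamma> C. \<exists>a2\<in>color_set \<gamma> C. \<exists>a3\<in>color_set \<gamma> C. \<exists>a4\<in>color_set \<gamma> C.
        [b = a1 + a2] (mod int p) \<and> [c = a3 + a4] (mod int p) \<and> [a1 + a3 = a2 + a4] (mod int p) \<and>
        (\<exists>d\<in>arc_residues p \<gamma> C. [d = a1 + a3] (mod int p)))}"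

lemma sym_arc_links: "sym (arc_links p \<gamma> C)"
proof (rule symI)
  fix b c assume "(b, c) \<in> arc_links p \<gamma> C"
  then obtain a1 a2 a3 a4 d where bc: "b \<in> arc_residues p \<gamma> C" "c \<in> arc_residues p \<gamma> C" "b \<noteq> c"
    and a: "a1 \<in> color_set \<gamma> C" "a2 \<in> color_set \<gamma> C" "a3 \<in> color_set \<gamma> C" "a4 \<in> color_set \<gamma> C"
    and h: "[b = a1 + a2] (mod int p)" "[c = a3 + a4] (mod int p)" "[a1 + a3 = a2 + a4] (mod int p)"
    and d: "d \<in> arc_residues p \<gamma> C" "[d = a1 + a3] (mod int p)"
    unfolding arc_links_def by blast
  have "[a3 + a1 = a4 + a2] (mod int p)" "[d = a3 + a1] (mod int p)" using h(3) d(2) by (simp_all add: add.commute)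
  then show "(c, b) \<in> arc_links p \<gamma> C"
    unfolding arc_links_def using bc(3)
    by (intro CollectI case_prodI conjI bc(1,2) not_sym[OF bc(3)] bexI[OF _ a(3)] bexI[OF _ a(4)]
      bexI[OF _ a(1)] bexI[OF _ a(2)] h(1,2) bexI[OF _ d(1)])
qed

text \<open>The Dehn relation says that the colour of the over-strand, x1 + x3 on one side and x2 +
  x4 on the other, does not jump modulo \<open>p\<close>; the under-strand passes from x3 + x4 to x1
  + x2. These sums are genuine arc residues because simple parameters occur arbitrarily close to the
  crossing.\<close>

lemma dehn_coloring_crossing:
  assumes gen: "generic_immersed_circle \<gamma>" and st: "(s, t) \<in> X" "X \<subseteq> double_points \<gamma>"
    and col: "dehn_coloring p \<gamma> X C"
  obtains x1 x2 x3 x4 where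
    "region_towards \<gamma> (\<gamma> s) (velocity \<gamma> s + velocity \<gamma> t) x1"
    "region_towards \<gamma> (\<gamma> s) (- velocity \<gamma> s + velocity \<gamma> t) x2"
    "region_towards \<gamma> (\<gamma> s) (velocity \<gamma> s - velocity \<gamma> t) x3"
    "region_towards \<gamma> (\<gamma> s) (- velocity \<gamma> s - velocity \<gamma> t) x4"
    "[C x1 + C x3 = C x2 + C x4] (mod int p)"
    "\<forall>\<^sub>F h in at_right 0. arc_colour \<gamma> C (s + h) mod int p = (C x1 + C x3) mod int p"
    "\<forall>\<^sub>F h in at_right 0. arc_colour \<gamma> C (s - h) mod int p = (C x1 + C x3) mod int p"
    "\<forall>\<^sub>F h in at_right 0. arc_colour \<gamma> C (t + h) mod int p = (C x1 + C x2) mod int p"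
    "\<forall>\<^sub>F h in at_right 0. arc_colour \<gamma> C (t - h) mod int p = (C x3 + C x4) mod int p"
    "(C x1 + C x3) mod int p \<in> arc_residues p \<gamma> C"
    "(C x1 + C x2) mod int p \<in> arc_residues p \<gamma> C"
    "(C x3 + C x4) mod int p \<in> arc_residues p \<gamma> C"
proof -
  have "(s, t) \<in> double_points \<gamma>" using st by blast
  then obtain x1 x2 x3 x4 where
    x: "region_towards \<gamma> (\<gamma> s) (velocity \<gamma> s + velocity \<gamma> t) x1"
    "region_towards \<gamma> (\<gamma> s) (- velocity \<gamma> s + velocity \<gamma> t) x2"
    "region_towards \<gamma> (\<gamma> s) (velocity \<gamma> s - velocity \<gamma> t) x3"
    "region_towards \<gamma> (\<gamma> s) (- velocity \<gamma> s - velocity \<gamma> t) x4"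
    and e: "\<forall>\<^sub>F h in at_right 0. simple_at \<gamma> (s + h) \<longrightarrow> arc_colour \<gamma> C (s + h) = C x1 + C x3"
    "\<forall>\<^sub>F h in at_right 0. simple_at \<gamma> (s - h) \<longrightarrow> arc_colour \<gamma> C (s - h) = C x2 + C x4"
    "\<forall>\<^sub>F h in at_right 0. simple_at \<gamma> (t + h) \<longrightarrow> arc_colour \<gamma> C (t + h) = C x1 + C x2"
    "\<forall>\<^sub>F h in at_right 0. simple_at \<gamma> (t - h) \<longrightarrow> arc_colour \<gamma> C (t - h) = C x3 + C x4"
    by (rule crossing_colours[OF gen])
  have "surrounding_regions \<gamma> (s, t) x1 x2 x3 x4"
    unfolding surrounding_regions_def using x
    by (intro bexI[of _ "velocity \<gamma> s"] bexI[of _ "velocity \<gamma> t"]) simp_all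
  then have rel: "[C x1 + C x3 = C x2 + C x4] (mod int p)"
    using col st(1) unfolding dehn_coloring_def by blast
  have shift: "\<forall>\<^sub>F h in at_right 0. simple_at \<gamma> (r + h)" "\<forall>\<^sub>F h in at_right 0. simple_at \<gamma> (r - h)" for r
  proof -
    have "\<forall>\<^sub>F h in at 0. simple_at \<gamma> (h + r)"
      using eventually_simple_at[OF gen, of r] by (subst (asm) at_to_0) (simp add: eventually_filtermap)
    then show "\<forall>\<^sub>F h in at_right 0. simple_at \<gamma> (r + h)" "\<forall>\<^sub>F h in at_right 0. simple_at \<gamma> (r - h)"
      by (auto simp: eventually_at_split at_left_minus[of 0] eventually_filtermap add.commute)
  qed
  have ev: "\<forall>\<^sub>F h in at_right 0. arc_colour \<gamma> C (f h) mod int p = m mod int p" "m mod int p \<in> arc_residues p \<gamma> C"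
    if "\<forall>\<^sub>F h in at_right (0::real). simple_at \<gamma> (f h)"
      "\<forall>\<^sub>F h in at_right 0. simple_at \<gamma> (f h) \<longrightarrow> arc_colour \<gamma> C (f h) = m" for f m
  proof -
    have "\<forall>\<^sub>F h in at_right 0. simple_at \<gamma> (f h) \<and> arc_colour \<gamma> C (f h) mod int p = m mod int p"
      using that by eventually_elim simp
    then show "\<forall>\<^sub>F h in at_right 0. arc_colour \<gamma> C (f h) mod int p = m mod int p"
      by (rule eventually_mono) simp
    obtain h where "simple_at \<gamma> (f h)" "arc_colour \<gamma> C (f h) mod int p = m mod int p"
      using eventually_happens[OF \<open>\<forall>\<^sub>F h in at_right 0. simple_at \<gamma> (f h) \<and> _\<close>] trivial_limit_at_right_real
      by blast
    then show "m mod int p \<in> arc_residues p \<gamma> C"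
      unfolding arc_residues_def by (intro image_eqI[where x = "f h"]) simp_all
  qed
  have "(C x2 + C x4) mod int p = (C x1 + C x3) mod int p" using rel by (simp add: cong_def)
  then show thesis
    using that[OF x rel ev(1)[OF shift(1) e(1)] _ ev(1)[OF shift(1) e(3)] ev(1)[OF shift(2) e(4)]
      ev(2)[OF shift(1) e(1)] ev(2)[OF shift(1) e(3)] ev(2)[OF shift(2) e(4)]]
      ev(1)[OF shift(2) e(2)] by simp
qed

lemma arc_residues_sum:
  assumes "immersed_circle \<gamma>" "b \<in> arc_residues p \<gamma> C"
  shows "\<exists>a1\<in>color_set \<gamma> C. \<exists>a2\<in>color_set \<gamma> C. [b = a1 + a2] (mod int p)"
proof -
  obtain t where t: "simple_at \<gamma> t" "b = arc_colour \<gamma> C t mod int p"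
    using assms(2) by (auto simp: arc_residues_def)
  obtain R R' where R: "R \<in> regions \<gamma>" "R' \<in> regions \<gamma>"
    and ev: "\<forall>\<^sub>F x in nhds t. simple_at \<gamma> x \<longrightarrow> arc_colour \<gamma> C x = C R + C R'"
    by (rule arc_colour_locally_const[OF assms(1) t(1)])
  have "arc_colour \<gamma> C t = C R + C R'" using eventually_nhds_x_imp_x[OF ev] t(1) by simp
  then have "[b = C R + C R'] (mod int p)" using t(2) by (simp add: cong_def)
  then show ?thesis using R unfolding color_set_def by blast
qed

text \<open>Links are symmetric, so the set of residues reachable from \<open>b\<close> is its
  connected component and serves as a name for it.\<close>

lemma arc_links_rtrancl_Image_eq:
  assumes "b = c \<or> (b, c) \<in> arc_links p \<gamma> C"
  shows "(arc_links p \<gamma> C)\<^sup>* `` {b} = (arc_links p \<gamma> C)\<^sup>* `` {c}"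
proof -
  have "(b, c) \<in> (arc_links p \<gamma> C)\<^sup>*" using assms by auto
  moreover have "(c, b) \<in> (arc_links p \<gamma> C)\<^sup>*"
    using sym_rtrancl[OF sym_arc_links] calculation by (rule symD)
  ultimately show ?thesis by (auto intro: rtrancl_trans)
qed

text \<open>At a simple point or an overpass the residue itself does not change; at an underpass it
  changes at most along a link. Punctured neighbourhoods are used because the arc colour has no
  meaning at a crossing parameter.\<close>

lemma linked_class_locally_const:
  assumes dg: "knot_diagram \<gamma> X" and col: "dehn_coloring p \<gamma> X C"
  shows "\<exists>g. (\<forall>\<^sub>F x in at t. (arc_links p \<gamma> C)\<^sup>* `` {arc_colour \<gamma> C x mod int p} = g) \<and>
    (simple_at \<gamma> t \<longrightarrow> (arc_links p \<gamma> C)\<^sup>* `` {arc_colour \<gamma> C t mod int p} = g)"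
proof (cases "simple_at \<gamma> t")
  case True
  have gen: "generic_immersed_circle \<gamma>" using dg by (simp add: knot_diagram_def)
  then have im: "immersed_circle \<gamma>" by (simp add: generic_immersed_circle_def)
  obtain R R' where ev: "\<forall>\<^sub>F x in nhds t. simple_at \<gamma> x \<longrightarrow> arc_colour \<gamma> C x = C R + C R'"
    by (rule arc_colour_locally_const[OF im True])
  have "\<forall>\<^sub>F x in at t. simple_at \<gamma> x \<longrightarrow> arc_colour \<gamma> C x = C R + C R'"
    using ev by (rule eventually_nhds_conv_at[THEN iffD1, THEN conjunct1])
  then have "\<forall>\<^sub>F x in at t. (arc_links p \<gamma> C)\<^sup>* `` {arc_colour \<gamma> C x mod int p} =
      (arc_links p \<gamma> C)\<^sup>* `` {(C R + C R') mod int p}"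
    using eventually_simple_at[OF gen, of t] by eventually_elim simp
  moreover have "arc_colour \<gamma> C t = C R + C R'" using eventually_nhds_x_imp_x[OF ev] True by simp
  ultimately show ?thesis by auto
next
  case False
  have gen: "generic_immersed_circle \<gamma>" and X: "X \<subseteq> double_points \<gamma>"
    and choice: "\<And>s t. (s, t) \<in> double_points \<gamma> \<Longrightarrow> (s, t) \<in> X \<or> (t, s) \<in> X"
    using dg unfolding knot_diagram_def by blast+
  then have im: "immersed_circle \<gamma>" by (simp add: generic_immersed_circle_def)
  obtain s where s: "(frac t, s) \<in> double_points \<gamma>"
    using not_simple_at_imp_double_point[OF im False] .
  have "\<exists>b c. (\<forall>\<^sub>F h in at_right 0. arc_colour \<gamma> C (frac t + h) mod int p = b) \<and>
      (\<forall>\<^sub>F h in at_right 0. arc_colour \<gamma> C (frac t - h) mod int p = c) \<and>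
      (b = c \<or> (b, c) \<in> arc_links p \<gamma> C)"
  proof (cases "(frac t, s) \<in> X")
    case True
    show ?thesis
      by (rule dehn_coloring_crossing[OF gen True X col]) blast
  next
    case False
    then have sX: "(s, frac t) \<in> X" using choice[OF s] by blast
    show ?thesis
    proof (rule dehn_coloring_crossing[OF gen sX X col])
      fix x1 x2 x3 x4
      assume x: "region_towards \<gamma> (\<gamma> s) (velocity \<gamma> s + velocity \<gamma> (frac t)) x1"
        "region_towards \<gamma> (\<gamma> s) (- velocity \<gamma> s + velocity \<gamma> (frac t)) x2"
        "region_towards \<gamma> (\<gamma> s) (velocity \<gamma> s - velocity \<gamma> (frac t)) x3"
        "region_towards \<gamma> (\<gamma> s) (- velocity \<gamma> s - velocity \<gamma> (frac t)) x4"
        and rel: "[C x1 + C x3 = C x2 + C x4] (mod int p)"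
        and ev: "\<forall>\<^sub>F h in at_right 0. arc_colour \<gamma> C (frac t + h) mod int p = (C x1 + C x2) mod int p"
        "\<forall>\<^sub>F h in at_right 0. arc_colour \<gamma> C (frac t - h) mod int p = (C x3 + C x4) mod int p"
        and res: "(C x1 + C x3) mod int p \<in> arc_residues p \<gamma> C"
        "(C x1 + C x2) mod int p \<in> arc_residues p \<gamma> C"
        "(C x3 + C x4) mod int p \<in> arc_residues p \<gamma> C"
      have S: "C x1 \<in> color_set \<gamma> C" "C x2 \<in> color_set \<gamma> C" "C x3 \<in> color_set \<gamma> C" "C x4 \<in> color_set \<gamma> C"
        using x by (auto simp: region_towards_def color_set_def)
      have m: "[a mod int p = a] (mod int p)" for a by (simp add: cong_def)
      \<comment> \<open>With a1, ..., a4 the colours of x1, ..., x4, the Dehn relation is the edge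
        condition and the over-arc residue is the midpoint.\<close>
      have "((C x1 + C x2) mod int p, (C x3 + C x4) mod int p) \<in> arc_links p \<gamma> C"
        if ne: "(C x1 + C x2) mod int p \<noteq> (C x3 + C x4) mod int p"
        unfolding arc_links_def
        by (intro CollectI case_prodI conjI res(2,3) ne bexI[OF _ S(1)] bexI[OF _ S(2)]
          bexI[OF _ S(3)] bexI[OF _ S(4)] m rel bexI[OF _ res(1)])
      then show ?thesis using ev by blast
    qed
  qed
  then obtain b c where bc: "\<forall>\<^sub>F h in at_right 0. arc_colour \<gamma> C (frac t + h) mod int p = b"
      "\<forall>\<^sub>F h in at_right 0. arc_colour \<gamma> C (frac t - h) mod int p = c" "b = c \<or> (b, c) \<in> arc_links p \<gamma> C"
    by blast
  \<comment> \<open>Double points are recorded with parameters in [0, 1), so an arbitrary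
    \<open>t\<close> is moved there by its floor.\<close>
  have per: "arc_colour \<gamma> C (t + h) = arc_colour \<gamma> C (frac t + h)" for h
    using arc_colour_plus_of_int[OF im, of C "frac t + h" "\<lfloor>t\<rfloor>"] by (simp add: frac_def)
  have "\<forall>\<^sub>F h in at 0. (arc_links p \<gamma> C)\<^sup>* `` {arc_colour \<gamma> C (h + t) mod int p} = (arc_links p \<gamma> C)\<^sup>* `` {b}"
  proof -
    have "\<forall>\<^sub>F h in at_right 0. (arc_links p \<gamma> C)\<^sup>* `` {arc_colour \<gamma> C (t + h) mod int p} = (arc_links p \<gamma> C)\<^sup>* `` {b}"
      using bc(1) by eventually_elim (simp add: per)
    moreover have "\<forall>\<^sub>F h in at_right 0. (arc_links p \<gamma> C)\<^sup>* `` {arc_colour \<gamma> C (t + - h) mod int p} = (arc_links p \<gamma> C)\<^sup>* `` {b}"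
      using bc(2) unfolding arc_links_rtrancl_Image_eq[OF bc(3)]
      by eventually_elim (simp only: per, simp)
    ultimately show ?thesis
      by (simp add: eventually_at_split at_left_minus[of 0] eventually_filtermap add.commute)
  qed
  then have "\<forall>\<^sub>F x in at t. (arc_links p \<gamma> C)\<^sup>* `` {arc_colour \<gamma> C x mod int p} = (arc_links p \<gamma> C)\<^sup>* `` {b}"
    by (subst at_to_0) (simp add: eventually_filtermap)
  with False show ?thesis by blast
qed

text \<open>The component seen in a punctured neighbourhood of \<open>t\<close> makes sense at
  crossings too. It is a locally constant function on the connected real line, hence
  constant.\<close>

lemma arc_links_connected:
  assumes dg: "knot_diagram \<gamma> X" and col: "dehn_coloring p \<gamma> X C"
    and b: "b \<in> arc_residues p \<gamma> C" and c: "c \<in> arc_residues p \<gamma> C"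
  shows "(b, c) \<in> (arc_links p \<gamma> C)\<^sup>*"
proof -
  have gen: "generic_immersed_circle \<gamma>" using dg by (simp add: knot_diagram_def)
  define cl where "cl = (\<lambda>t. (arc_links p \<gamma> C)\<^sup>* `` {arc_colour \<gamma> C t mod int p})"
  obtain g where g: "\<And>t. \<forall>\<^sub>F x in at t. cl x = g t" "\<And>t. simple_at \<gamma> t \<Longrightarrow> cl t = g t"
    using linked_class_locally_const[OF dg col] unfolding cl_def by metis
  have const: "g s = g t" for s t
  proof (rule connected_local_const[of UNIV])
    show "\<forall>a\<in>UNIV. \<forall>\<^sub>F x in at a. g a = g x"
    proof
      fix a
      show "\<forall>\<^sub>F x in at a. g a = g x"
        using g(1)[of a] eventually_simple_at[OF gen, of a] by eventually_elim (simp add: g(2)[symmetric])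
    qed
  qed simp_all
  obtain s t where "simple_at \<gamma> s" "b = arc_colour \<gamma> C s mod int p"
    "simple_at \<gamma> t" "c = arc_colour \<gamma> C t mod int p"
    using b c by (auto simp: arc_residues_def)
  then have "(arc_links p \<gamma> C)\<^sup>* `` {b} = (arc_links p \<gamma> C)\<^sup>* `` {c}"
    using g(2)[of s] g(2)[of t] const[of s t] by (simp add: cl_def)
  then show ?thesis by blast
qed

text \<open>At a nontrivially colored crossing the over-arc differs from an under-arc: if x1 + x3
  and x1 + x2 had the same colour, then x3 and x2 would agree, and by the Dehn relation so would x1
  and x4. Colours are reduced residues, so congruence is equality.\<close>

lemma arc_residues_nontrivial:
  assumes "0 < p" and dg: "knot_diagram \<gamma> X" and col: "dehn_coloring p \<gamma> X C"
    and nt: "nontrivial_coloring \<gamma> X C"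
  shows "2 \<le> card (arc_residues p \<gamma> C)"
proof -
  have gen: "generic_immersed_circle \<gamma>" and X: "X \<subseteq> double_points \<gamma>"
    using dg unfolding knot_diagram_def by blast+
  obtain s t y1 y2 y3 y4 where st: "(s, t) \<in> X"
    and y: "surrounding_regions \<gamma> (s, t) y1 y2 y3 y4" "\<not> (C y1 = C y4 \<and> C y3 = C y2)"
    using nt unfolding nontrivial_coloring_def trivially_colored_def by fastforce
  obtain x1 x2 x3 x4 where
    x: "region_towards \<gamma> (\<gamma> s) (velocity \<gamma> s + velocity \<gamma> t) x1"
    "region_towards \<gamma> (\<gamma> s) (- velocity \<gamma> s + velocity \<gamma> t) x2"
    "region_towards \<gamma> (\<gamma> s) (velocity \<gamma> s - velocity \<gamma> t) x3"
    "region_towards \<gamma> (\<gamma> s) (- velocity \<gamma> s - velocity \<gamma> t) x4"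
    and rel: "[C x1 + C x3 = C x2 + C x4] (mod int p)"
    and res: "(C x1 + C x3) mod int p \<in> arc_residues p \<gamma> C" "(C x1 + C x2) mod int p \<in> arc_residues p \<gamma> C"
    by (rule dehn_coloring_crossing[OF gen st X col])
  have ne: "\<not> (C x1 = C x4 \<and> C x3 = C x2)"
    using y(2) surrounding_regions_cases[OF y(1), of x1 x2 x3 x4] x by auto
  have Z: "C x1 \<in> {0..<int p}" "C x2 \<in> {0..<int p}" "C x3 \<in> {0..<int p}" "C x4 \<in> {0..<int p}"
    using col x by (auto simp: dehn_coloring_def region_towards_def Zmod_def Pi_def)
  have "(C x1 + C x3) mod int p \<noteq> (C x1 + C x2) mod int p"
  proof
    assume "(C x1 + C x3) mod int p = (C x1 + C x2) mod int p"
    then have "[C x3 = C x2] (mod int p)" by (metis cong_add_lcancel cong_def)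
    then have "C x3 = C x2" using Z by (simp add: cong_def)
    then have "[C x1 = C x4] (mod int p)" using rel by (metis add.commute cong_add_lcancel)
    then have "C x1 = C x4" using Z by (simp add: cong_def)
    with \<open>C x3 = C x2\<close> ne show False by blast
  qed
  moreover have "finite (arc_residues p \<gamma> C)"
    by (rule finite_subset[of _ "{0..<int p}"]) (use \<open>0 < p\<close> in \<open>auto simp: arc_residues_def\<close>)
  ultimately have "card {(C x1 + C x3) mod int p, (C x1 + C x2) mod int p} \<le> card (arc_residues p \<gamma> C)"
    using res by (intro card_mono) auto
  then show ?thesis using \<open>_ \<noteq> _\<close> by simp
qed

theorem theorem5p1:
  fixes p :: nat and S :: "int set"
  assumes "prime p" and "odd p"
    and "S \<subseteq> Zmod p"
    and "\<exists>\<gamma> X C. nontrivially_colored_diagram p \<gamma> X C \<and> S = color_set \<gamma> C"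
  shows "\<exists>V E. R_subgraph p S V E \<and> connected_graph V E \<and>
           int (card V) \<ge> \<lfloor>log 2 (real p)\<rfloor> + 2"
proof -
  obtain \<gamma> X C where dg: "knot_diagram \<gamma> X" and col: "dehn_coloring p \<gamma> X C"
    and nt: "nontrivial_coloring \<gamma> X C" and S: "S = color_set \<gamma> C"
    using assms(4) unfolding nontrivially_colored_diagram_def by blast
  have im: "immersed_circle \<gamma>"
    using dg by (simp add: knot_diagram_def generic_immersed_circle_def)
  have p: "0 < p" using assms(1) by (rule prime_gt_0_nat)
  show ?thesis
  proof (rule R_subgraph_of_connected_sums[OF assms(1,2), where R = "arc_links p \<gamma> C"])
    show "arc_residues p \<gamma> C \<subseteq> Zmod p" using p by (auto simp: arc_residues_def Zmod_def)
    show "2 \<le> card (arc_residues p \<gamma> C)" by (rule arc_residues_nontrivial[OF p dg col nt])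
    show "\<exists>a1\<in>S. \<exists>a2\<in>S. [b = a1 + a2] (mod int p)" if "b \<in> arc_residues p \<gamma> C" for b
      unfolding S by (rule arc_residues_sum[OF im that])
    show "(x, y) \<in> (arc_links p \<gamma> C)\<^sup>*" if "x \<in> arc_residues p \<gamma> C" "y \<in> arc_residues p \<gamma> C" for x y
      by (rule arc_links_connected[OF dg col that])
  qed (simp add: arc_links_def S)
qed

end
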